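(* For every real $t$ the following three identities hold, and in each of them the common value of the two sides is, as a function of $t$, a Lévy exponent: \begin{align*} (i)\quad & \int_0^\infty(\cos(tx)-1)\, \frac{\pi}{2}\,\frac{\cosh(\pi x/2)}{\sinh^2(\pi x/2)}\,dx= - t\tanh(t);\\ (ii)\quad & \int_0^\infty(\cos(tx)-1)\,\frac{\pi}{4}\,\mathrm{csch}\Big(\frac{\pi x}{2}\Big)\Big[\pi x\coth^2\Big(\frac{\pi x}{2}\Big)-2\coth\Big(\frac{\pi x}{2}\Big)+\pi x\, \mathrm{csch}^2\Big(\frac{\pi x}{2}\Big)\Big]dx\\ &\qquad = -t\tanh(t)-t^2\,\mathrm{sech}^2(t);\\ (iii)\quad & \int_0^\infty (\cos(tx)-1)\,\frac{\pi}{8}\,\mathrm{csch}\Big(\frac{\pi x}{2}\Big)\Big[(\pi x)^2\coth^{3}\Big(\frac{\pi x}{2}\Big) +\coth\Big(\frac{\pi x}{2}\Big)\Big(5(\pi x)^2\,\mathrm{csch}^{2}\Big(\frac{\pi x}{2}\Big)+4\Big)\\ &\qquad\qquad - 6\pi x\coth^2\Big(\frac{\pi x}{2}\Big)-6\pi x\, \mathrm{csch}^2\Big(\frac{\pi x}{2}\Big)\Big]dx = -t \tanh(t)-t^2\big(3-2t \tanh (t)\big)\, \mathrm{sech}^2(t). \end{align*}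
   Context: Here $\mathrm{csch}(u)=1/\sinh(u)$, $\mathrm{sech}(u)=1/\cosh(u)$ and $\coth(u)=\cosh(u)/\sinh(u)$. A Lévy exponent is a function $t\mapsto \log\phi(t)$, where $\phi$ is the characteristic function of an infinitely divisible probability distribution on $\mathbb{R}$. (The identities are associated with the selfdecomposable characteristic function $1/\cosh(t)$.) *)

theory Defs
  imports "HOL-Probability.Probability"
begin

definition csch :: "real \<Rightarrow> real" where
  "csch u = 1 / sinh u"

definition sech :: "real \<Rightarrow> real" where
  "sech u = 1 / cosh u"

definition coth :: "real \<Rightarrow> real" where
  "coth u = cosh u / sinh u"

text \<open>For every \<open>n \<ge> 1\<close>, the distribution is the law of a sum of \<open>n\<close> i.i.d. random variables,
  realised here as the coordinates of an \<open>n\<close>-fold product space.\<close>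

definition infinitely_divisible :: "real measure \<Rightarrow> bool" where
  "infinitely_divisible M \<longleftrightarrow> real_distribution M \<and>
     (\<forall>n::nat. n \<ge> 1 \<longrightarrow> (\<exists>N. real_distribution N \<and>
        M = distr (\<Pi>\<^sub>M i\<in>{..<n}. N) borel (\<lambda>x. \<Sum>i<n. x i)))"

text \<open>The logarithm of a characteristic function is the distinguished one: the continuous
  branch that vanishes at \<open>0\<close>. The principal branch \<^const>\<open>Ln\<close> would be wrong, since it may jump.\<close>

definition levy_exponent :: "(real \<Rightarrow> complex) \<Rightarrow> bool" where
  "levy_exponent \<psi> \<longleftrightarrow> continuous_on UNIV \<psi> \<and> \<psi> 0 = 0 \<and>
     (\<exists>M. infinitely_divisible M \<and> (\<forall>t. char M t = exp (\<psi> t)))"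

end

theory Submission
  imports Defs "HOL-Real_Asymp.Real_Asymp"
begin

text \<open>
  Why the theorem is true. Write \<open>K x = csch (\<pi>x/2)\<close>. The three Levy densities are not independent
  of each other: \<open>density_i\<close>, \<open>density_ii\<close> and \<open>density_iii\<close> are \<open>k\<^sub>1 = -K'\<close>, \<open>k\<^sub>2 = -(x k\<^sub>1)'\<close> and \<open>k\<^sub>3 = -(x k\<^sub>2)'\<close>. On the right-hand sides
  this is mirrored by \<open>\<psi>\<^sub>1 t = -t tanh t\<close>, \<open>\<psi>\<^sub>2 t = t \<psi>\<^sub>1' t\<close> and \<open>\<psi>\<^sub>3 t = t \<psi>\<^sub>2' t\<close>. The reason is that
  \<open>cos (t x)\<close> depends only on the product \<open>t x\<close>, so \<open>t \<partial>/\<partial>t\<close> and \<open>x \<partial>/\<partial>x\<close> act on it in the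
  same way, and an integration by parts moves \<open>x \<partial>/\<partial>x\<close> onto the density
  (\<open>LBINT_cos_minus_one_Euler\<close>). The same integration by parts reduces the first identity to the
  sine transform \<open>\<integral> sin (t x) csch (\<pi>x/2) dx = tanh t\<close> (\<open>LBINT_sin_csch\<close>), which follows by
  expanding \<open>csch\<close> into a geometric series, integrating term by term and recognising the partial
  fraction series of \<open>tanh\<close>; the latter is the logarithmic derivative of Euler's reflection
  formula for the Gamma function.

  An integral \<open>\<integral> (cos (t x) - 1) k x dx\<close> with \<open>k \<ge> 0\<close> and \<open>\<integral> x\<^sup>2 k x dx < \<infinity>\<close> is always a Levy exponent
  (\<open>levy_exponent_LBINT\<close>). If \<open>k\<close> is integrable, its exponential is the characteristic function of a
  compound Poisson law, obtained as a limit of powers of mixtures with the point mass at \<open>0\<close>. The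
  general case follows by cutting \<open>k\<close> off near \<open>0\<close>. Both limits rely on one compactness
  statement (\<open>real_char_limit\<close>): a bound \<open>1 - f t \<le> C t\<^sup>2\<close> that is uniform along a sequence of
  characteristic functions makes the laws tight, so that the pointwise limit is again a characteristic
  function. Infinite divisibility is then immediate, since \<open>k / n\<close> satisfies the same hypotheses.

  It remains to see that the densities are nonnegative. For \<open>k\<^sub>1\<close> this is clear, and for \<open>k\<^sub>2\<close> it
  follows from \<open>tanh u \<le> u\<close>. For \<open>k\<^sub>3\<close> the inequality is delicate: after clearing
  denominators it becomes \<open>hyperbolic_inequality\<close>, whose power series has two negative
  coefficients. These are outweighed by the other coefficients up to order \<open>12\<close>
  (\<open>quintic_pos\<close>), and all later ones are nonnegative.
\<close>

section \<open>Real-valued characteristic functions\<close>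

text \<open>The laws behind the three identities are symmetric, so their characteristic functions are real-valued.
  Recording these as functions into the reals keeps inequalities such as \<open>1 - f t \<le> C * t\<^sup>2\<close> free of real parts.\<close>

definition real_char :: "(real \<Rightarrow> real) \<Rightarrow> bool" where
  "real_char f \<longleftrightarrow> (\<exists>M. real_distribution M \<and> (\<forall>t. char M t = complex_of_real (f t)))"

lemma real_char_1: "real_char (\<lambda>_. 1)"
proof -
  have "real_distribution (return borel (0::real))"
    by (auto simp: real_distribution_def real_distribution_axioms_def intro!: prob_space_return)
  moreover have "char (return borel (0::real)) t = complex_of_real 1" for t
    by (simp add: char_def integral_return)
  ultimately show ?thesis unfolding real_char_def by blast
qed

lemma real_char_abs_le_1: "real_char f \<Longrightarrow> \<bar>f t\<bar> \<le> 1"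
  unfolding real_char_def using real_distribution.cmod_char_le_1 by (metis norm_of_real)

text \<open>The mixture is realised as the law of a random choice: an independent Bernoulli variable decides
  which of two independent variables, with laws \<open>M\<close> and \<open>N\<close>, is observed.\<close>

lemma char_mixture:
  assumes "real_distribution M" "real_distribution N" "0 \<le> p" "p \<le> 1"
  shows "\<exists>K. real_distribution K \<and> (\<forall>t. char K t = of_real p * char M t + of_real (1 - p) * char N t)"
proof -
  interpret M: real_distribution M by fact
  interpret N: real_distribution N by fact
  interpret MN: pair_prob_space M N ..
  let ?B = "measure_pmf (bernoulli_pmf p)"
  interpret BMN: pair_prob_space ?B "M \<Otimes>\<^sub>M N" ..
  define X :: "bool \<times> real \<times> real \<Rightarrow> real" where "X = (\<lambda>(b, x, y). if b then x else y)"
  have X[measurable]: "X \<in> borel_measurable (?B \<Otimes>\<^sub>M (M \<Otimes>\<^sub>M N))"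
    unfolding X_def by measurable
  let ?K = "distr (?B \<Otimes>\<^sub>M (M \<Otimes>\<^sub>M N)) borel X"
  have K: "real_distribution ?K"
    by (simp add: BMN.real_distribution_distr)
  have "char ?K t = of_real p * char M t + of_real (1 - p) * char N t" for t
  proof -
    have fst: "(CLINT z|M \<Otimes>\<^sub>M N. iexp (t * fst z)) = char M t"
    proof -
      have "char M t = char (distr (M \<Otimes>\<^sub>M N) M fst) t" by (simp add: N.distr_pair_fst)
      also have "\<dots> = (CLINT z|M \<Otimes>\<^sub>M N. iexp (t * fst z))"
        unfolding char_def by (subst integral_distr) auto
      finally show ?thesis ..
    qed
    have snd: "(CLINT z|M \<Otimes>\<^sub>M N. iexp (t * snd z)) = char N t"
    proof -
      have "(CLINT z|M \<Otimes>\<^sub>M N. iexp (t * snd z)) = (CLINT x|M. CLINT y|N. iexp (t * y))"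
        by (subst MN.integral_fst'[symmetric])
           (auto intro!: MN.P.integrable_const_bound[of _ 1])
      then show ?thesis by (simp add: char_def M.prob_space del: M.space_eq_univ)
    qed
    have "char ?K t = (CLINT z|(?B \<Otimes>\<^sub>M (M \<Otimes>\<^sub>M N)). iexp (t * X z))"
      by (simp add: char_def integral_distr)
    also have "\<dots> = (CLINT b|?B. CLINT z|M \<Otimes>\<^sub>M N. iexp (t * X (b, z)))"
      by (subst BMN.integral_fst'[symmetric])
         (auto intro!: BMN.P.integrable_const_bound[of _ 1])
    also have "\<dots> = (CLINT b|?B. if b then char M t else char N t)"
      by (intro Bochner_Integration.integral_cong refl)
         (auto simp: X_def case_prod_beta fst[simplified] snd[simplified])
    also have "\<dots> = of_real p * char M t + of_real (1 - p) * char N t"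
      using assms
      by (subst integral_measure_pmf[of UNIV]) (auto simp: UNIV_bool scaleR_conv_of_real)
    finally show ?thesis .
  qed
  with K show ?thesis by blast
qed

lemma real_char_mixture:
  assumes "real_char f" "real_char g" "0 \<le> p" "p \<le> 1"
  shows "real_char (\<lambda>t. p * f t + (1 - p) * g t)"
proof -
  obtain M N where "real_distribution M" "\<And>t. char M t = complex_of_real (f t)"
      "real_distribution N" "\<And>t. char N t = complex_of_real (g t)"
    using assms unfolding real_char_def by auto
  with char_mixture[of M N p] assms show ?thesis unfolding real_char_def by auto
qed

text \<open>Symmetrisation: the fair mixture of the law of \<open>X\<close> with the law of \<open>-X\<close>.\<close>

lemma real_char_Re:
  assumes "real_distribution M"
  shows "real_char (\<lambda>t. Re (char M t))"
proof -
  interpret M: real_distribution M by fact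
  have N: "real_distribution (distr M borel uminus)"
    by (simp add: M.real_distribution_distr)
  have *: "char (distr M borel uminus) t = cnj (char M t)" for t
  proof -
    have "char (distr M borel uminus) t = (CLINT x|M. cnj (iexp (t * x)))"
      unfolding char_def by (subst integral_distr) (simp_all add: exp_cnj)
    then show ?thesis unfolding char_def by simp
  qed
  obtain K where "real_distribution K"
      "\<And>t. char K t = of_real (1/2) * char M t + of_real (1 - 1/2) * cnj (char M t)"
    using char_mixture[OF assms N, of "1/2"] by (auto simp: *)
  moreover have "of_real (1/2) * z + of_real (1 - 1/2) * cnj z = complex_of_real (Re z)" for z
    by (simp add: complex_eq_iff)
  ultimately show ?thesis unfolding real_char_def by auto
qed

lemma char_sum_iid:
  assumes "real_distribution N"
  shows "real_distribution (distr (\<Pi>\<^sub>M i\<in>{..<n}. N) borel (\<lambda>x. \<Sum>i<n. x i))" (is ?A)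
    and "char (distr (\<Pi>\<^sub>M i\<in>{..<n}. N) borel (\<lambda>x. \<Sum>i<n. x i)) t = char N t ^ n" (is ?B)
proof -
  interpret N: real_distribution N by fact
  interpret P: product_prob_space "\<lambda>_. N" "{..<n}" ..
  have comp: "distr (\<Pi>\<^sub>M i\<in>{..<n}. N) borel (\<lambda>x. x i) = N" if "i < n" for i
  proof -
    have "distr (\<Pi>\<^sub>M i\<in>{..<n}. N) borel (\<lambda>x. x i) = distr (\<Pi>\<^sub>M i\<in>{..<n}. N) N (\<lambda>x. x i)"
      by (rule distr_cong) auto
    also have "\<dots> = N" using that by (intro distr_PiM_component) (auto intro: N.prob_space_axioms)
    finally show ?thesis .
  qed
  show ?A by (rule P.real_distribution_distr) simp
  show ?B
  proof (cases "n = 0")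
    case True
    then show ?thesis
      using prob_space.prob_space[OF prob_space_PiM[of "{}::nat set" "\<lambda>_. N"]]
      by (simp add: char_def integral_distr N.prob_space_axioms)
  next
    case False
    have indep: "P.indep_vars (\<lambda>i. borel) (\<lambda>i x. x i) {..<n}"
    proof (subst P.indep_vars_iff_distr_eq_PiM')
      have "distr (Pi\<^sub>M {..<n} (\<lambda>i. N)) (Pi\<^sub>M {..<n} (\<lambda>i. borel)) (\<lambda>x. \<lambda>i\<in>{..<n}. x i)
          = distr (Pi\<^sub>M {..<n} (\<lambda>i. N)) (Pi\<^sub>M {..<n} (\<lambda>i. N)) (\<lambda>x. x)"
        by (rule distr_cong) (auto intro!: sets_PiM_cong simp: space_PiM)
      also have "\<dots> = Pi\<^sub>M {..<n} (\<lambda>i. N)" by simp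
      also have "\<dots> = Pi\<^sub>M {..<n} (\<lambda>i. distr (Pi\<^sub>M {..<n} (\<lambda>i. N)) borel (\<lambda>x. x i))"
        by (intro PiM_cong) (auto simp: comp)
      finally show "distr (Pi\<^sub>M {..<n} (\<lambda>i. N)) (Pi\<^sub>M {..<n} (\<lambda>i. borel)) (\<lambda>x. \<lambda>i\<in>{..<n}. x i) = \<dots>" .
    qed (use False in auto)
    then have "char (distr (\<Pi>\<^sub>M i\<in>{..<n}. N) borel (\<lambda>x. \<Sum>i<n. x i)) t
      = (\<Prod>i<n. char (distr (\<Pi>\<^sub>M i\<in>{..<n}. N) borel (\<lambda>x. x i)) t)"
      by (rule P.char_distr_sum)
    also have "\<dots> = char N t ^ n" by (simp add: comp)
    finally show ?thesis .
  qed
qed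

lemma real_char_power:
  assumes "real_char f"
  shows "real_char (\<lambda>t. f t ^ n)"
proof -
  obtain N where "real_distribution N" "\<And>t. char N t = complex_of_real (f t)"
    using assms unfolding real_char_def by auto
  with char_sum_iid[of N n] show ?thesis unfolding real_char_def by auto
qed

text \<open>The hypothesis for \<open>n = 1\<close> provides the law itself and for general \<open>n\<close> a candidate for its
  \<open>n\<close>-th convolution root. That the candidate is a root follows by comparing characteristic functions
  and using that they determine the law.\<close>

lemma levy_exponent_if_real_char:
  assumes cont: "continuous_on UNIV \<psi>" and "\<psi> 0 = 0"
    and root: "\<And>n. n \<ge> 1 \<Longrightarrow> real_char (\<lambda>t. exp (\<psi> t / real n))"
  shows "levy_exponent (\<lambda>t. complex_of_real (\<psi> t))"
proof -
  obtain M where M: "real_distribution M" "\<And>t. char M t = complex_of_real (exp (\<psi> t))"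
    using root[of 1] unfolding real_char_def by auto
  have "\<exists>N. real_distribution N \<and> M = distr (\<Pi>\<^sub>M i\<in>{..<n}. N) borel (\<lambda>x. \<Sum>i<n. x i)"
    if n: "n \<ge> 1" for n :: nat
  proof -
    obtain N where N: "real_distribution N" "\<And>t. char N t = complex_of_real (exp (\<psi> t / real n))"
      using root[OF n] unfolding real_char_def by auto
    have "char M t = char N t ^ n" for t
      using n by (simp add: M N exp_of_nat_mult[symmetric] flip: of_real_power)
    then have "char M = char (distr (\<Pi>\<^sub>M i\<in>{..<n}. N) borel (\<lambda>x. \<Sum>i<n. x i))"
      by (simp add: fun_eq_iff char_sum_iid(2)[OF N(1)])
    then show ?thesis
      using Levy_uniqueness[OF M(1) char_sum_iid(1)[OF N(1)]] N(1) by blast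
  qed
  then have "infinitely_divisible M" using M(1) unfolding infinitely_divisible_def by blast
  then show ?thesis
    using assms M unfolding levy_exponent_def
    by (auto intro!: exI[of _ M] continuous_on_of_real simp: exp_of_real)
qed

section \<open>Limits of characteristic functions with a quadratic bound\<close>

text \<open>The average of \<open>1 - cos (y * X / a)\<close> over \<open>X\<close> and an independent standard normal \<open>y\<close> can be
  computed in two orders. Averaging over \<open>X\<close> first, the hypothesis on \<open>f\<close> and the unit variance of
  \<open>y\<close> bound it by \<open>C / a\<^sup>2\<close>. Averaging over \<open>y\<close> first gives the expectation of
  \<open>1 - exp (- (X / a)\<^sup>2 / 2)\<close>, which is at least \<open>1 / 3\<close> on the tail event.\<close>

lemma real_char_tail:
  assumes M: "real_distribution M" "\<And>t. char M t = complex_of_real (f t)"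
    and C: "\<And>t. 1 - f t \<le> C * t\<^sup>2" and a: "a > 0"
  shows "measure M {x. \<bar>x\<bar> \<ge> a} \<le> 3 * C / a\<^sup>2"
proof -
  interpret M: real_distribution M by fact
  interpret N: prob_space std_normal_distribution by (rule prob_space_normal_density) simp
  interpret MN: pair_prob_space M std_normal_distribution ..
  have fb: "\<bar>f t\<bar> \<le> 1" for t using M real_char_abs_le_1 unfolding real_char_def by blast
  define g where "g = (\<lambda>z. 1 - cos (snd z * fst z / a) :: real)"
  have fm[measurable]: "f \<in> borel_measurable borel"
  proof -
    have "f = (\<lambda>t. Re (char M t))" by (simp add: M)
    then show ?thesis using M.char_measurable by simp
  qed
  have [measurable]: "g \<in> borel_measurable (M \<Otimes>\<^sub>M std_normal_distribution)"
    unfolding g_def by measurable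
  have gi: "integrable (M \<Otimes>\<^sub>M std_normal_distribution) g"
  proof (rule MN.P.integrable_const_bound[of _ 2])
    have "norm (g z) \<le> 2" for z
      using cos_ge_minus_one[of "snd z * fst z / a"] cos_le_one[of "snd z * fst z / a"]
      by (simp add: g_def)
    then show "AE z in M \<Otimes>\<^sub>M std_normal_distribution. norm (g z) \<le> 2" by simp
  qed simp
  have cosM: "(LINT x|M. cos (t * x)) = f t" for t
  proof -
    have "(LINT x|M. cos (t * x)) = Re (char M t)"
      unfolding char_def by (subst integral_Re[symmetric])
        (auto intro!: M.integrable_iexp simp: Re_exp)
    then show ?thesis by (simp add: M)
  qed
  have cosN: "(LINT y|std_normal_distribution. cos (y * s)) = exp (- s\<^sup>2 / 2)" for s
  proof -
    have "(LINT y|std_normal_distribution. cos (y * s)) = Re (char std_normal_distribution s)"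
      unfolding char_def by (subst integral_Re[symmetric])
        (auto intro!: N.integrable_iexp simp: Re_exp mult.commute)
    then show ?thesis by (simp add: char_std_normal_distribution)
  qed
  have L: "(LINT z|(M \<Otimes>\<^sub>M std_normal_distribution). g z) = (LINT x|M. 1 - exp (- (x / a)\<^sup>2 / 2))"
  proof -
    have "(LINT y|std_normal_distribution. g (x, y)) = 1 - exp (- (x / a)\<^sup>2 / 2)" for x
    proof -
      have "(LINT y|std_normal_distribution. g (x, y)) = (LINT y|std_normal_distribution. 1 - cos (y * (x / a)))"
        by (simp add: g_def)
      also have "\<dots> = (LINT y|std_normal_distribution. 1) - (LINT y|std_normal_distribution. cos (y * (x / a)))"
        by (rule Bochner_Integration.integral_diff) (auto intro!: N.integrable_const_bound[of _ 1])
      also have "\<dots> = 1 - exp (- (x / a)\<^sup>2 / 2)"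
        by (simp only: cosN lebesgue_integral_const N.prob_space scaleR_one)
      finally show ?thesis .
    qed
    then show ?thesis by (subst MN.integral_fst'[OF gi, symmetric]) simp
  qed
  have R: "(LINT z|(M \<Otimes>\<^sub>M std_normal_distribution). g z) = (LINT y|std_normal_distribution. 1 - f (y / a))"
  proof -
    have "(LINT x|M. g (x, y)) = 1 - f (y / a)" for y
    proof -
      have "(LINT x|M. g (x, y)) = (LINT x|M. 1 - cos ((y / a) * x))"
        by (simp add: g_def)
      also have "\<dots> = (LINT x|M. 1) - (LINT x|M. cos ((y / a) * x))"
        by (rule Bochner_Integration.integral_diff) (auto intro!: M.integrable_const_bound[of _ 1])
      also have "\<dots> = 1 - f (y / a)"
        by (simp only: cosM lebesgue_integral_const M.prob_space scaleR_one)
      finally show ?thesis .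
    qed
    then show ?thesis using MN.integral_snd[of "\<lambda>x y. g (x, y)"] gi by simp
  qed
  have sq: "(LINT y|std_normal_distribution. y\<^sup>2) = 1"
    using std_normal_distribution_even_moments[of 1] by simp
  have "(LINT y|std_normal_distribution. 1 - f (y / a)) \<le> (LINT y|std_normal_distribution. C / a\<^sup>2 * y\<^sup>2)"
  proof (rule integral_mono)
    show "integrable std_normal_distribution (\<lambda>y. 1 - f (y / a))"
    proof (rule N.integrable_const_bound[of _ 2])
      have "norm (1 - f (y / a)) \<le> 2" for y using fb[of "y / a"] by simp
      then show "AE y in std_normal_distribution. norm (1 - f (y / a)) \<le> 2" by simp
    qed simp
    show "integrable std_normal_distribution (\<lambda>y. C / a\<^sup>2 * y\<^sup>2)"
      using integrable_std_normal_distribution_moment[of 2] by simp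
    show "1 - f (y / a) \<le> C / a\<^sup>2 * y\<^sup>2" for y
      using C[of "y / a"] by (simp add: power_divide)
  qed
  also have "\<dots> = C / a\<^sup>2" by (simp add: sq)
  finally have up: "(LINT x|M. 1 - exp (- (x / a)\<^sup>2 / 2)) \<le> C / a\<^sup>2" using L R by simp
  have e: "1 - exp (- 1 / 2) \<ge> (1/3 :: real)"
  proof -
    have "(1::real) + 1/2 \<le> exp (1/2)" by (rule exp_ge_add_one_self)
    then have "exp (- 1/2) \<le> (2/3::real)" by (simp add: exp_minus field_simps)
    then show ?thesis by simp
  qed
  have "measure M {x. \<bar>x\<bar> \<ge> a} / 3 = (LINT x|M. indicator {x. \<bar>x\<bar> \<ge> a} x / 3)"
    by simp
  also have "\<dots> \<le> (LINT x|M. 1 - exp (- (x / a)\<^sup>2 / 2))"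
  proof (rule integral_mono)
    show "integrable M (\<lambda>x. indicator {x. \<bar>x\<bar> \<ge> a} x / 3 :: real)"
      by (intro M.integrable_const_bound[of _ 1]) (auto simp: indicator_def)
    show "integrable M (\<lambda>x. 1 - exp (- (x / a)\<^sup>2 / 2))"
      by (intro M.integrable_const_bound[of _ 1]) auto
    show "indicator {x. \<bar>x\<bar> \<ge> a} x / 3 \<le> 1 - exp (- (x / a)\<^sup>2 / 2)" for x
    proof (cases "\<bar>x\<bar> \<ge> a")
      case True
      then have "(x / a)\<^sup>2 \<ge> 1" using a
        using abs_le_square_iff[of 1 "x / a"] by simp
      then have "exp (- (x / a)\<^sup>2 / 2) \<le> exp (- 1 / 2)" by simp
      moreover have "indicator {x. \<bar>x\<bar> \<ge> a} x / 3 = (1 / 3 :: real)" using True by simp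
      ultimately show ?thesis using e by linarith
    qed simp
  qed
  finally show ?thesis using up by simp
qed

text \<open>The uniform quadratic bound yields tightness by \<open>real_char_tail\<close>. Helly's selection theorem then
  provides a law that is the weak limit of a subsequence, and its characteristic function can only be \<open>g\<close>.\<close>

lemma real_char_limit:
  assumes f: "\<And>n. real_char (f n)" and C: "\<And>n t. 1 - f n t \<le> C * t\<^sup>2"
    and lim: "\<And>t. (\<lambda>n. f n t) \<longlonglongrightarrow> g t"
  shows "real_char g"
proof -
  obtain M where M: "\<And>n. real_distribution (M n)" "\<And>n t. char (M n) t = complex_of_real (f n t)"
    using f unfolding real_char_def by metis
  have C0: "C \<ge> 0" using C[of 0 1] real_char_abs_le_1[OF f, of 0 1] by force
  have "tight M"
    unfolding tight_def
  proof (intro conjI allI impI)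
    fix e :: real assume e: "e > 0"
    define a where "a = sqrt (3 * C / e) + 1"
    have a: "a > 0" using C0 e by (simp add: a_def add_nonneg_pos)
    have "3 * C / e < a\<^sup>2"
    proof -
      have "3 * C / e = (sqrt (3 * C / e))\<^sup>2" using C0 e by simp
      also have "\<dots> < a\<^sup>2" unfolding a_def using C0 e by (intro power_strict_mono) auto
      finally show ?thesis .
    qed
    then have small: "3 * C / a\<^sup>2 < e" using a e by (simp add: field_simps)
    have "measure (M n) {- a<..a} > 1 - e" for n
    proof -
      interpret M: real_distribution "M n" by (rule M)
      have "measure (M n) (UNIV - {x. \<bar>x\<bar> \<ge> a}) = 1 - measure (M n) {x. \<bar>x\<bar> \<ge> a}"
        using M.prob_compl[of "{x. \<bar>x\<bar> \<ge> a}"] by simp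
      moreover have "measure (M n) (UNIV - {x. \<bar>x\<bar> \<ge> a}) \<le> measure (M n) {- a<..a}"
        by (intro M.finite_measure_mono) auto
      moreover have "measure (M n) {x. \<bar>x\<bar> \<ge> a} \<le> 3 * C / a\<^sup>2"
        by (rule real_char_tail[OF M(1) M(2) C a])
      ultimately show ?thesis using small by linarith
    qed
    then show "\<exists>a b. a < b \<and> (\<forall>n. measure (M n) {a<..b} > 1 - e)"
      using a by (intro exI[of _ "- a"] exI[of _ a]) auto
  qed (rule M)
  then obtain r K where r: "strict_mono (r :: nat \<Rightarrow> nat)" and K: "real_distribution K"
      and weak: "weak_conv_m (M \<circ> id \<circ> r) K"
    using tight_imp_convergent_subsubsequence[of M id] by (auto simp: strict_mono_id id_def)
  have "char K t = complex_of_real (g t)" for t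
  proof (rule LIMSEQ_unique)
    show "(\<lambda>n. char ((M \<circ> id \<circ> r) n) t) \<longlonglongrightarrow> char K t"
      by (rule levy_continuity1[OF _ K weak]) (simp add: M)
    show "(\<lambda>n. char ((M \<circ> id \<circ> r) n) t) \<longlonglongrightarrow> complex_of_real (g t)"
      using LIMSEQ_subseq_LIMSEQ[OF lim r, of t] by (auto simp: M o_def intro!: tendsto_of_real)
  qed
  with K show ?thesis unfolding real_char_def by blast
qed

section \<open>From Levy densities to characteristic functions\<close>

text \<open>The target is the limit of \<open>(1 + l * (f t - 1) / m) ^ m\<close>, the characteristic function of a sum of
  \<open>m\<close> independent terms, each of which is set to \<open>0\<close> with probability \<open>1 - l / m\<close> and is otherwise
  drawn from the law with characteristic function \<open>f\<close>. Bernoulli's inequality makes the quadratic bound uniform in \<open>m\<close>.\<close>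

lemma real_char_compound_poisson:
  assumes f: "real_char f" and C: "\<And>t. 1 - f t \<le> C * t\<^sup>2" and l: "l \<ge> 0"
  shows "real_char (\<lambda>t. exp (l * (f t - 1)))"
proof (rule real_char_limit)
  \<comment> \<open>The offset ensures \<open>m n \<ge> 2 * l\<close>, so that every base is at least \<open>-1\<close>, as Bernoulli requires.\<close>
  define m where "m = (\<lambda>n. n + (nat \<lceil>2 * l\<rceil> + 1))"
  have m: "real (m n) > 0" "real (m n) \<ge> 2 * l" for n
    unfolding m_def by linarith+
  have eq: "1 + l * (f t - 1) / m n = (l / m n) * f t + (1 - l / m n) * 1" for n t
    by (simp add: algebra_simps diff_divide_distrib)
  have "real_char (\<lambda>t. (l / m n) * f t + (1 - l / m n) * 1)" for n
    using m[of n] l by (intro real_char_mixture f real_char_1) (auto simp: field_simps)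
  then show "real_char (\<lambda>t. (1 + l * (f t - 1) / m n) ^ m n)" for n
    unfolding eq by (rule real_char_power)
  show "1 - (1 + l * (f t - 1) / m n) ^ m n \<le> (l * C) * t\<^sup>2" for n t
  proof -
    have "\<bar>f t\<bar> \<le> 1" using real_char_abs_le_1[OF f] .
    then have "l * (1 - f t) \<le> l * 2" using l by (intro mult_left_mono) auto
    also have "\<dots> \<le> m n" using m[of n] by simp
    finally have "l * (f t - 1) / m n \<ge> -1" using m[of n] by (simp add: field_simps)
    then have "1 + real (m n) * (l * (f t - 1) / m n) \<le> (1 + l * (f t - 1) / m n) ^ m n"
      by (rule Bernoulli_inequality)
    moreover have "real (m n) * (l * (f t - 1) / m n) = l * (f t - 1)"
      using m[of n] by simp
    ultimately have "1 - (1 + l * (f t - 1) / m n) ^ m n \<le> l * (1 - f t)"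
      by (simp only: right_diff_distrib)
    also have "\<dots> \<le> l * (C * t\<^sup>2)" by (intro mult_left_mono C l)
    finally show ?thesis by simp
  qed
  show "(\<lambda>n. (1 + l * (f t - 1) / m n) ^ m n) \<longlonglongrightarrow> exp (l * (f t - 1))" for t
    unfolding m_def
    by (rule LIMSEQ_ignore_initial_segment[OF tendsto_exp_limit_sequentially])
qed

lemma one_minus_cos_le: "1 - cos x \<le> x\<^sup>2 / (2::real)"
proof -
  have "1 - cos x = 2 * (sin (x/2))\<^sup>2" using cos_double_sin[of "x/2"] by simp
  also have "\<dots> \<le> 2 * (x/2)\<^sup>2"
    using abs_sin_x_le_abs_x[of "x/2"] by (intro mult_left_mono) (auto simp: abs_le_square_iff[symmetric])
  finally show ?thesis by (simp add: power2_eq_square)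
qed

lemma abs_cos_minus_one_le: "\<bar>(cos (t * x) - 1) * y\<bar> \<le> t\<^sup>2 / 2 * \<bar>x\<^sup>2 * y\<bar>" for t x y :: real
proof -
  have "\<bar>cos (t * x) - 1\<bar> = 1 - cos (t * x)" by simp
  then show ?thesis using mult_right_mono[OF one_minus_cos_le[of "t * x"], of "\<bar>y\<bar>"]
    by (simp add: abs_mult power_mult_distrib mult_ac)
qed

lemma integrable_cos_minus_one:
  assumes "integrable lborel (\<lambda>x::real. x\<^sup>2 * k x :: real)" and [measurable]: "k \<in> borel_measurable borel"
  shows "integrable lborel (\<lambda>x. (cos (t * x) - 1) * k x)"
  by (rule Bochner_Integration.integrable_bound[OF integrable_mult_right[OF integrable_abs[OF assms(1)], of "t\<^sup>2/2"]])
     (use abs_cos_minus_one_le in \<open>auto intro!: AE_I2 simp: abs_mult\<close>)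

text \<open>After division by its total mass \<open>l\<close>, an integrable \<open>k\<close> is the density of a jump distribution, and
  the claim becomes the compound Poisson case with rate \<open>l\<close>.\<close>

lemma real_char_exp_finite_levy:
  assumes k0: "\<And>x. k x \<ge> 0" and ki: "integrable lborel k" and k2: "integrable lborel (\<lambda>x::real. x\<^sup>2 * k x)"
  shows "real_char (\<lambda>t. exp (LINT x|lborel. (cos (t * x) - 1) * k x))"
proof -
  have [measurable]: "k \<in> borel_measurable borel" using ki by auto
  define l where "l = (LINT x|lborel. k x)"
  have l0: "l \<ge> 0" unfolding l_def using k0 by simp
  have split: "(LINT x|lborel. (cos (t * x) - 1) * k x) = (LINT x|lborel. cos (t * x) * k x) - l" for t
  proof -
    have "integrable lborel (\<lambda>x. cos (t * x) * k x)"
      by (rule Bochner_Integration.integrable_bound[OF ki])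
         (auto simp: abs_mult intro!: AE_I2 mult_left_le_one_le)
    then show ?thesis unfolding l_def
      by (subst Bochner_Integration.integral_diff[symmetric]) (auto simp: ki algebra_simps)
  qed
  show ?thesis
  \<comment> \<open>If \<open>k\<close> vanishes almost everywhere it cannot be normalised; the law is then the point mass at \<open>0\<close>.\<close>
  proof (cases "l = 0")
    case True
    then have "AE x in lborel. k x = 0"
      using integral_nonneg_eq_0_iff_AE[OF ki] k0 by (auto simp: l_def)
    then have "(LINT x|lborel. (cos (t * x) - 1) * k x) = 0" for t
      by (subst integral_cong_AE[of _ _ "\<lambda>_. 0"]) auto
    then show ?thesis using real_char_1 by simp
  next
    case False
    with l0 have l: "l > 0" by simp
    define M where "M = density lborel (\<lambda>x. ennreal (k x / l))"
    have "emeasure M (space M) = 1"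
    proof -
      have "emeasure M (space M) = (\<integral>\<^sup>+x. ennreal (k x / l) \<partial>lborel)"
        unfolding M_def by (subst emeasure_density) auto
      also have "\<dots> = ennreal (LINT x|lborel. k x / l)"
        using ki k0 l by (intro nn_integral_eq_integral) auto
      also have "\<dots> = 1" using l by (simp add: l_def)
      finally show ?thesis .
    qed
    then have M: "real_distribution M"
      by (auto simp: real_distribution_def real_distribution_axioms_def M_def intro!: prob_spaceI)
    interpret M: real_distribution M by fact
    define f where "f = (\<lambda>t. Re (char M t))"
    have f: "f t = (LINT x|lborel. cos (t * x) * k x) / l" for t
    proof -
      have "f t = (LINT x|M. cos (t * x))"
        unfolding f_def char_def by (subst integral_Re[symmetric])
          (auto intro!: M.integrable_iexp simp: Re_exp)
      also have "\<dots> = (LINT x|lborel. (k x / l) * cos (t * x))"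
        unfolding M_def using k0 l by (subst integral_density) auto
      finally show ?thesis by (simp add: mult.commute)
    qed
    have lf: "l * (f t - 1) = (LINT x|lborel. (cos (t * x) - 1) * k x)" for t
      using l unfolding split f by (simp add: field_simps)
    have "real_char (\<lambda>t. exp (l * (f t - 1)))"
    proof (rule real_char_compound_poisson[OF _ _ l0])
      show "real_char f" unfolding f_def by (rule real_char_Re[OF M])
      show "1 - f t \<le> ((LINT x|lborel. x\<^sup>2 * k x) / (2 * l)) * t\<^sup>2" for t
      proof -
        have "- (LINT x|lborel. (cos (t * x) - 1) * k x) = (LINT x|lborel. (1 - cos (t * x)) * k x)"
          by (subst integral_minus[symmetric]) (simp add: algebra_simps)
        also have "\<dots> \<le> (LINT x|lborel. t\<^sup>2 / 2 * (x\<^sup>2 * k x))"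
        proof (rule integral_mono)
          show "integrable lborel (\<lambda>x. (1 - cos (t * x)) * k x)"
            using integrable_minus[OF integrable_cos_minus_one[OF k2, of t]] by (simp add: algebra_simps)
          show "integrable lborel (\<lambda>x. t\<^sup>2 / 2 * (x\<^sup>2 * k x))" using k2 by simp
          show "(1 - cos (t * x)) * k x \<le> t\<^sup>2 / 2 * (x\<^sup>2 * k x)" for x
            using abs_cos_minus_one_le[of t x "k x"] k0[of x] by (simp add: abs_mult)
        qed
        also have "\<dots> = t\<^sup>2 / 2 * (LINT x|lborel. x\<^sup>2 * k x)" by simp
        finally have "l * (1 - f t) \<le> t\<^sup>2 / 2 * (LINT x|lborel. x\<^sup>2 * k x)"
          by (simp only: lf[symmetric]) (simp add: algebra_simps)
        then show ?thesis using l by (simp add: field_simps)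
      qed
    qed
    then show ?thesis by (simp add: lf)
  qed
qed

text \<open>Removing the jumps of size at most \<open>1 / Suc n\<close> makes the density integrable, because there
  \<open>k x \<le> (Suc n)\<^sup>2 * (x\<^sup>2 * k x)\<close>. The second moment of \<open>k\<close> bounds those of all truncations, and this
  is the uniform quadratic bound needed for passing to the limit.\<close>

theorem real_char_exp_levy:
  assumes k0: "\<And>x. k x \<ge> 0" and km[measurable]: "k \<in> borel_measurable borel"
    and k2: "integrable lborel (\<lambda>x::real. x\<^sup>2 * k x)"
  shows "real_char (\<lambda>t. exp (LINT x|lborel. (cos (t * x) - 1) * k x))"
proof (rule real_char_limit)
  define kn where "kn = (\<lambda>n x. indicator {x. \<bar>x\<bar> > 1 / Suc n} x * k x)"
  have [measurable]: "kn n \<in> borel_measurable borel" for n unfolding kn_def by measurable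
  have kn0: "kn n x \<ge> 0" "kn n x \<le> k x" for n x using k0 by (auto simp: kn_def indicator_def)
  have kn2: "integrable lborel (\<lambda>x. x\<^sup>2 * kn n x)" for n
    by (rule Bochner_Integration.integrable_bound[OF k2])
       (use kn0 k0 in \<open>auto intro!: AE_I2 mult_left_mono simp: abs_mult\<close>)
  have kni: "integrable lborel (kn n)" for n
  proof (rule Bochner_Integration.integrable_bound[OF integrable_mult_right[OF k2, of "(Suc n)\<^sup>2"]])
    have "\<bar>kn n x\<bar> \<le> (real (Suc n))\<^sup>2 * (x\<^sup>2 * k x)" for x
    proof (cases "\<bar>x\<bar> > 1 / Suc n")
      case True
      then have "1 \<le> \<bar>Suc n * x\<bar>" by (simp add: field_simps abs_mult)
      then have "1 \<le> (Suc n * x)\<^sup>2" using abs_le_square_iff[of 1 "Suc n * x"] by simp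
      then have "1 * k x \<le> (Suc n * x)\<^sup>2 * k x" using k0 by (intro mult_right_mono)
      then show ?thesis using True k0[of x] by (simp add: kn_def power_mult_distrib mult_ac)
    next
      case False then show ?thesis using k0[of x] by (simp add: kn_def)
    qed
    then show "AE x in lborel. norm (kn n x) \<le> norm (real ((Suc n)\<^sup>2) * (x\<^sup>2 * k x))"
      using k0 by (auto simp: abs_mult)
  qed simp
  show "real_char (\<lambda>t. exp (LINT x|lborel. (cos (t * x) - 1) * kn n x))" for n
    by (rule real_char_exp_finite_levy[OF kn0(1) kni kn2])
  show "1 - exp (LINT x|lborel. (cos (t * x) - 1) * kn n x) \<le> ((LINT x|lborel. x\<^sup>2 * k x) / 2) * t\<^sup>2" for n t
  proof -
    have "1 - exp (LINT x|lborel. (cos (t * x) - 1) * kn n x) \<le> - (LINT x|lborel. (cos (t * x) - 1) * kn n x)"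
      using exp_ge_add_one_self[of "LINT x|lborel. (cos (t * x) - 1) * kn n x"] by linarith
    also have "\<dots> = (LINT x|lborel. (1 - cos (t * x)) * kn n x)"
      by (subst integral_minus[symmetric]) (simp add: algebra_simps)
    also have "\<dots> \<le> (LINT x|lborel. t\<^sup>2 / 2 * (x\<^sup>2 * k x))"
    proof (rule integral_mono)
      show "integrable lborel (\<lambda>x. (1 - cos (t * x)) * kn n x)"
        using integrable_minus[OF integrable_cos_minus_one[OF kn2, of n t]] by (simp add: algebra_simps)
      show "integrable lborel (\<lambda>x. t\<^sup>2 / 2 * (x\<^sup>2 * k x))" using k2 by simp
      show "(1 - cos (t * x)) * kn n x \<le> t\<^sup>2 / 2 * (x\<^sup>2 * k x)" for x
      proof -
        have "(1 - cos (t * x)) * kn n x \<le> (1 - cos (t * x)) * k x"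
          using kn0 by (intro mult_left_mono) auto
        then show ?thesis
          using abs_cos_minus_one_le[of t x "k x"] k0[of x] by (simp add: abs_mult)
      qed
    qed
    finally show ?thesis by (simp add: mult.commute)
  qed
  show "(\<lambda>n. exp (LINT x|lborel. (cos (t * x) - 1) * kn n x)) \<longlonglongrightarrow> exp (LINT x|lborel. (cos (t * x) - 1) * k x)" for t
  proof (intro tendsto_exp integral_dominated_convergence[where w = "\<lambda>x. \<bar>(cos (t * x) - 1) * k x\<bar>"])
    show "integrable lborel (\<lambda>x. \<bar>(cos (t * x) - 1) * k x\<bar>)"
      using integrable_cos_minus_one[OF k2 km] by (rule integrable_abs)
    show "AE x in lborel. norm ((cos (t * x) - 1) * kn n x) \<le> \<bar>(cos (t * x) - 1) * k x\<bar>" for n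
      using kn0 k0 by (auto simp: abs_mult intro!: mult_left_mono)
    have "(\<lambda>n. (cos (t * x) - 1) * kn n x) \<longlonglongrightarrow> (cos (t * x) - 1) * k x" for x
    proof (cases "x = 0")
      case False
      have "(\<lambda>n. 1 / real (Suc n)) \<longlonglongrightarrow> 0" using LIMSEQ_inverse_real_of_nat by (simp add: inverse_eq_divide)
      then have "\<forall>\<^sub>F n in sequentially. 1 / real (Suc n) < \<bar>x\<bar>"
        using False by (auto simp: order_tendsto_iff)
      then have "\<forall>\<^sub>F n in sequentially. (cos (t * x) - 1) * kn n x = (cos (t * x) - 1) * k x"
        by eventually_elim (simp add: kn_def)
      then show ?thesis by (rule tendsto_eventually)
    qed simp
    then show "AE x in lborel. (\<lambda>n. (cos (t * x) - 1) * kn n x) \<longlonglongrightarrow> (cos (t * x) - 1) * k x"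
      by simp
  qed measurable
qed

text \<open>The density \<open>k / n\<close> produces the \<open>n\<close>-th root of the exponential, so the hypotheses, being
  stable under scaling, already give infinite divisibility.\<close>

theorem levy_exponent_LBINT:
  fixes k \<psi> :: "real \<Rightarrow> real"
  assumes k: "continuous_on {0<..} k" and k0: "\<And>x. x > 0 \<Longrightarrow> k x \<ge> 0"
    and ki: "set_integrable lborel {0<..} (\<lambda>x. x\<^sup>2 * k x)"
    and \<psi>: "\<And>t. (LBINT x:{0<..}. (cos (t * x) - 1) * k x) = \<psi> t" and cont: "continuous_on UNIV \<psi>"
  shows "levy_exponent (\<lambda>t. complex_of_real (\<psi> t))"
proof (rule levy_exponent_if_real_char[OF cont])
  show "\<psi> 0 = 0" by (simp flip: \<psi> add: set_lebesgue_integral_def)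
  show "real_char (\<lambda>t. exp (\<psi> t / real n))" if "n \<ge> 1" for n :: nat
  proof -
    let ?k = "\<lambda>x. indicator {0<..} x *\<^sub>R k x / real n"
    have "real_char (\<lambda>t. exp (LINT x|lborel. (cos (t * x) - 1) * ?k x))"
    proof (rule real_char_exp_levy)
      show "?k x \<ge> 0" for x using k0[of x] by (simp add: indicator_def)
      show "?k \<in> borel_measurable borel"
        using borel_measurable_continuous_on_indicator[OF _ k] by simp
      show "integrable lborel (\<lambda>x. x\<^sup>2 * ?k x)"
        using integrable_divide[OF ki[unfolded set_integrable_def], of "real n"] by (simp add: mult_ac)
    qed
    moreover have "(LINT x|lborel. (cos (t * x) - 1) * ?k x) = \<psi> t / real n" for t
    proof -
      have "(LINT x|lborel. (cos (t * x) - 1) * ?k x)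
          = (LINT x|lborel. (indicator {0<..} x *\<^sub>R ((cos (t * x) - 1) * k x)) / real n)"
        by (intro Bochner_Integration.integral_cong) (auto simp: mult_ac)
      also have "\<dots> = (LBINT x:{0<..}. (cos (t * x) - 1) * k x) / real n"
        unfolding set_lebesgue_integral_def by (rule integral_divide_zero)
      finally show ?thesis by (simp add: \<psi>)
    qed
    ultimately show ?thesis by (simp only:)
  qed
qed

section \<open>Integration on the positive half-line\<close>

lemma set_integrable_half_line_bound:
  fixes f g :: "real \<Rightarrow> real"
  assumes "set_integrable lborel {0<..} f" "continuous_on {0<..} g" "\<And>x. x > 0 \<Longrightarrow> \<bar>g x\<bar> \<le> f x"
  shows "set_integrable lborel {0<..} g"
proof (rule set_integrable_bound[OF assms(1)])
  show "set_borel_measurable lborel {0<..} g"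
    using borel_measurable_continuous_on_indicator[OF _ assms(2)]
    by (simp add: set_borel_measurable_def)
  show "AE x in lborel. x \<in> {0<..} \<longrightarrow> norm (g x) \<le> norm (f x)"
    using assms(3) by (intro AE_I2) force
qed

text \<open>Limits at both ends make \<open>(1 + x\<^sup>2) * f x\<close> bounded on the half-line, so that \<open>f\<close> is dominated by a
  multiple of the integrable function \<open>1 / (1 + x\<^sup>2)\<close>.\<close>

lemma set_integrable_half_line_limits:
  fixes f :: "real \<Rightarrow> real"
  assumes cont: "continuous_on {0<..} f"
    and zero: "((\<lambda>x. (1 + x\<^sup>2) * f x) \<longlongrightarrow> a) (at_right 0)"
    and infinity: "((\<lambda>x. (1 + x\<^sup>2) * f x) \<longlongrightarrow> b) at_top"
  shows "set_integrable lborel {0<..} f"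
proof -
  let ?g = "\<lambda>x. (1 + x\<^sup>2) * f x"
  have "\<forall>\<^sub>F x in at_right 0. \<bar>?g x\<bar> < \<bar>a\<bar> + 1"
    using tendsto_rabs[OF zero] by (auto simp: order_tendsto_iff)
  then obtain d where d: "d > 0" "\<And>x. 0 < x \<Longrightarrow> x < d \<Longrightarrow> \<bar>?g x\<bar> < \<bar>a\<bar> + 1"
    by (auto simp: eventually_at_right_field)
  have "\<forall>\<^sub>F x in at_top. \<bar>?g x\<bar> < \<bar>b\<bar> + 1"
    using tendsto_rabs[OF infinity] by (auto simp: order_tendsto_iff)
  then obtain N where N: "\<And>x. x \<ge> N \<Longrightarrow> \<bar>?g x\<bar> < \<bar>b\<bar> + 1"
    by (auto simp: eventually_at_top_linorder)
  have "compact (?g ` {d..N})"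
    using d by (intro compact_continuous_image continuous_intros continuous_on_subset[OF cont]) auto
  then obtain B where B: "\<And>x. x \<in> {d..N} \<Longrightarrow> \<bar>?g x\<bar> \<le> B"
    using compact_imp_bounded bounded_iff by (metis (no_types, lifting) imageI real_norm_def)
  define C where "C = Max {\<bar>a\<bar> + 1, \<bar>b\<bar> + 1, B}"
  have "\<bar>?g x\<bar> \<le> C" if "x > 0" for x
    using d(2)[OF that] N[of x] B[of x] unfolding C_def
    by (cases "x < d"; cases "x \<ge> N") auto
  then have bound: "\<bar>f x\<bar> \<le> C * (1 / (1 + x\<^sup>2))" if "x > 0" for x
  proof -
    have pos: "1 + x\<^sup>2 > 0" by (simp add: add_pos_nonneg)
    then have "\<bar>?g x\<bar> = \<bar>f x\<bar> * (1 + x\<^sup>2)" by (simp add: abs_mult)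
    then show ?thesis using \<open>\<And>x. x > 0 \<Longrightarrow> \<bar>?g x\<bar> \<le> C\<close>[OF that] pos
      by (simp add: pos_le_divide_eq)
  qed
  have "set_integrable lborel {0<..} (\<lambda>x. 1 / (1 + x\<^sup>2) :: real)"
    using integrable_I0i_1_div_plus_square
    by (simp add: interval_lebesgue_integrable_def zero_ereal_def)
  then have "set_integrable lborel {0<..} (\<lambda>x. C * (1 / (1 + x\<^sup>2)))"
    by (rule set_integrable_mult_right)
  then show ?thesis by (rule set_integrable_half_line_bound[OF _ cont bound])
qed

lemma LBINT_half_line_FTC:
  fixes F f :: "real \<Rightarrow> real"
  assumes F: "\<And>x. x > 0 \<Longrightarrow> (F has_real_derivative f x) (at x)"
    and cont: "continuous_on {0<..} f" and f: "set_integrable lborel {0<..} f"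
    and "(F \<longlongrightarrow> A) (at_right 0)" "(F \<longlongrightarrow> B) at_top"
  shows "(LBINT x:{0<..}. f x) = B - A"
proof -
  have "(LBINT x=ereal 0..\<infinity>. f x) = B - A"
  proof (rule interval_integral_FTC_integrable)
    show "isCont f x" if "ereal 0 < ereal x" for x
      using cont that by (simp add: continuous_on_eq_continuous_at)
  qed (use assms in \<open>auto simp: ereal_tendsto_simps has_real_derivative_iff_has_vector_derivative\<close>)
  then show ?thesis by (simp add: interval_integral_Ioi)
qed

lemma set_integrable_cos_minus_one:
  fixes k :: "real \<Rightarrow> real"
  assumes "continuous_on {0<..} k" "set_integrable lborel {0<..} (\<lambda>x. x\<^sup>2 * k x)"
  shows "set_integrable lborel {0<..} (\<lambda>x. (cos (t * x) - 1) * k x)"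
proof (rule set_integrable_half_line_bound)
  show "set_integrable lborel {0<..} (\<lambda>x. t\<^sup>2 / 2 * \<bar>x\<^sup>2 * k x\<bar>)"
    by (intro set_integrable_mult_right set_integrable_abs assms)
  show "\<bar>(cos (t * x) - 1) * k x\<bar> \<le> t\<^sup>2 / 2 * \<bar>x\<^sup>2 * k x\<bar>" for x
    by (rule abs_cos_minus_one_le)
qed (intro continuous_intros assms)

lemma set_integrable_sin_times:
  fixes h :: "real \<Rightarrow> real"
  assumes "continuous_on {0<..} h" "set_integrable lborel {0<..} (\<lambda>x. x * h x)"
  shows "set_integrable lborel {0<..} (\<lambda>x. sin (t * x) * h x)"
proof (rule set_integrable_half_line_bound)
  show "set_integrable lborel {0<..} (\<lambda>x. \<bar>t\<bar> * \<bar>x * h x\<bar>)"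
    by (intro set_integrable_mult_right set_integrable_abs assms)
  show "\<bar>sin (t * x) * h x\<bar> \<le> \<bar>t\<bar> * \<bar>x * h x\<bar>" if "x > 0" for x
    using mult_right_mono[OF abs_sin_x_le_abs_x[of "t * x"], of "\<bar>h x\<bar>"]
    by (simp add: abs_mult mult_ac)
qed (auto intro!: continuous_intros assms)

section \<open>The Euler operator on Levy densities\<close>

text \<open>An antiderivative of the difference of the two integrands is \<open>- (cos (t * x) - 1) * h x\<close>. It vanishes at
  infinity with \<open>h\<close>, and at \<open>0\<close> with \<open>x\<^sup>2 * h x\<close>, since the cosine factor is \<open>O(x\<^sup>2)\<close>.\<close>

lemma LBINT_cos_minus_one_by_parts:
  fixes h k :: "real \<Rightarrow> real"
  assumes h: "\<And>x. x > 0 \<Longrightarrow> (h has_real_derivative - k x) (at x)"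
    and k: "continuous_on {0<..} k" and ki: "set_integrable lborel {0<..} (\<lambda>x. x\<^sup>2 * k x)"
    and hi: "set_integrable lborel {0<..} (\<lambda>x. x * h x)"
    and h0: "((\<lambda>x. x\<^sup>2 * h x) \<longlongrightarrow> 0) (at_right 0)" and h_inf: "(h \<longlongrightarrow> 0) at_top"
  shows "(LBINT x:{0<..}. (cos (t * x) - 1) * k x) = - t * (LBINT x:{0<..}. sin (t * x) * h x)"
proof -
  let ?F = "\<lambda>x. - (cos (t * x) - 1) * h x"
  have hc: "continuous_on {0<..} h"
    using h by (intro DERIV_continuous_on) (auto intro: has_field_derivative_at_within)
  note i1 = set_integrable_cos_minus_one[OF k ki, of t]
  note i2 = set_integrable_mult_right[OF set_integrable_sin_times[OF hc hi, of t], of t]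
  have "(LBINT x:{0<..}. (cos (t * x) - 1) * k x + t * (sin (t * x) * h x)) = 0 - 0"
  proof (rule LBINT_half_line_FTC[where F = ?F])
    show "(?F has_real_derivative (cos (t * x) - 1) * k x + t * (sin (t * x) * h x)) (at x)"
      if "x > 0" for x
      using h[OF that] by (auto intro!: derivative_eq_intros simp: algebra_simps)
    show "continuous_on {0<..} (\<lambda>x. (cos (t * x) - 1) * k x + t * (sin (t * x) * h x))"
      by (intro continuous_intros k hc)
    show "set_integrable lborel {0<..} (\<lambda>x. (cos (t * x) - 1) * k x + t * (sin (t * x) * h x))"
      by (rule set_integral_add(1)[OF i1 i2])
    show "(?F \<longlongrightarrow> 0) (at_right 0)"
    proof (rule Lim_null_comparison)
      show "\<forall>\<^sub>F x in at_right 0. norm (?F x) \<le> t\<^sup>2 / 2 * \<bar>x\<^sup>2 * h x\<bar>"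
        using abs_cos_minus_one_le[of t] by (auto simp: abs_mult)
      show "((\<lambda>x. t\<^sup>2 / 2 * \<bar>x\<^sup>2 * h x\<bar>) \<longlongrightarrow> 0) (at_right 0)"
        using tendsto_mult_right_zero[OF tendsto_rabs_zero[OF h0]] .
    qed
    show "(?F \<longlongrightarrow> 0) at_top"
    proof (rule Lim_null_comparison)
      have "\<bar>cos (t * x) - 1\<bar> \<le> 2" for x
        using cos_ge_minus_one[of "t * x"] cos_le_one[of "t * x"] by linarith
      then show "\<forall>\<^sub>F x in at_top. norm (?F x) \<le> 2 * \<bar>h x\<bar>"
        by (intro always_eventually allI) (simp only: real_norm_def abs_mult abs_minus_cancel, intro mult_right_mono, auto)
      show "((\<lambda>x. 2 * \<bar>h x\<bar>) \<longlongrightarrow> 0) at_top"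
        using tendsto_mult_right_zero[OF tendsto_rabs_zero[OF h_inf]] .
    qed
  qed
  then show ?thesis
    using set_integral_add(2)[OF i1 i2] by (simp add: set_integral_mult_right)
qed

text \<open>Differentiation under the integral sign. Writing the difference of cosines as a product of sines
  bounds the difference quotients by a multiple of \<open>x\<^sup>2 * \<bar>k x\<bar>\<close>, locally uniformly in the parameter.\<close>

lemma has_derivative_LBINT_cos_minus_one:
  fixes k :: "real \<Rightarrow> real"
  assumes k: "continuous_on {0<..} k" and ki: "set_integrable lborel {0<..} (\<lambda>x. x\<^sup>2 * k x)"
  shows "((\<lambda>t. LBINT x:{0<..}. (cos (t * x) - 1) * k x) has_real_derivative
           - (LBINT x:{0<..}. sin (t * x) * (x * k x))) (at t)"
proof -
  let ?\<psi> = "\<lambda>t. LBINT x:{0<..}. (cos (t * x) - 1) * k x"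
  have "((\<lambda>s. (?\<psi> s - ?\<psi> t) / (s - t)) \<longlongrightarrow> (LBINT x:{0<..}. - sin (t * x) * (x * k x))) (at t within UNIV)"
    unfolding tendsto_at_iff_sequentially comp_def
  proof (intro allI impI)
    fix s assume "\<forall>i. s i \<in> UNIV - {t}" and lim: "s \<longlonglongrightarrow> t"
    then have st: "s i \<noteq> t" for i by blast
    obtain B where B: "\<And>i. \<bar>s i\<bar> \<le> B"
      using convergent_imp_Bseq[of s] lim by (auto simp: Bseq_def convergent_def)
    let ?q = "\<lambda>i x. (cos (s i * x) - cos (t * x)) / (s i - t) * k x"
    have quot: "(?\<psi> (s i) - ?\<psi> t) / (s i - t) = (LBINT x:{0<..}. ?q i x)" for i
    proof -
      have "?\<psi> (s i) - ?\<psi> t = (LBINT x:{0<..}. (cos (s i * x) - 1) * k x - (cos (t * x) - 1) * k x)"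
        using set_integrable_cos_minus_one[OF k ki] by (intro set_integral_diff(2)[symmetric])
      also have "\<dots> = (LBINT x:{0<..}. (s i - t) * ?q i x)"
      proof (intro set_lebesgue_integral_cong allI impI)
        fix x :: real
        have "(s i - t) * ?q i x = (cos (s i * x) - cos (t * x)) * k x" using st[of i] by simp
        then show "(cos (s i * x) - 1) * k x - (cos (t * x) - 1) * k x = (s i - t) * ?q i x"
          by (simp add: algebra_simps)
      qed simp
      finally show ?thesis using st[of i] by (simp add: set_integral_mult_right)
    qed
    have "(\<lambda>i. LBINT x:{0<..}. ?q i x) \<longlonglongrightarrow> (LBINT x:{0<..}. - sin (t * x) * (x * k x))"
      unfolding set_lebesgue_integral_def
    proof (rule integral_dominated_convergence[where w = "\<lambda>x. indicator {0<..} x *\<^sub>R ((B + \<bar>t\<bar>) / 2 * \<bar>x\<^sup>2 * k x\<bar>)"])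
      show "integrable lborel (\<lambda>x. indicator {0<..} x *\<^sub>R ((B + \<bar>t\<bar>) / 2 * \<bar>x\<^sup>2 * k x\<bar>))"
        using set_integrable_mult_right[OF set_integrable_abs[OF ki], of "(B + \<bar>t\<bar>) / 2"]
        by (simp add: set_integrable_def)
      have meas: "(\<lambda>x. indicator {0<..} x *\<^sub>R g x) \<in> borel_measurable lborel"
        if "continuous_on {0<..} g" for g :: "real \<Rightarrow> real"
        using borel_measurable_continuous_on_indicator[OF _ that] by simp
      show "(\<lambda>x. indicator {0<..} x *\<^sub>R (- sin (t * x) * (x * k x))) \<in> borel_measurable lborel"
        by (intro meas continuous_intros k)
      show "(\<lambda>x. indicator {0<..} x *\<^sub>R ?q i x) \<in> borel_measurable lborel" for i
        using st[of i] by (intro meas continuous_intros k) auto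
      show "AE x in lborel. norm (indicator {0<..} x *\<^sub>R ?q i x)
            \<le> indicator {0<..} x *\<^sub>R ((B + \<bar>t\<bar>) / 2 * \<bar>x\<^sup>2 * k x\<bar>)" for i
      proof (intro AE_I2)
        fix x :: real
        have "\<bar>cos (s i * x) - cos (t * x)\<bar>
            = 2 * \<bar>sin ((s i * x + t * x) / 2)\<bar> * \<bar>sin ((t * x - s i * x) / 2)\<bar>"
          by (subst cos_diff_cos) (simp add: abs_mult)
        also have "\<dots> \<le> 2 * \<bar>(s i * x + t * x) / 2\<bar> * \<bar>(t * x - s i * x) / 2\<bar>"
          by (intro mult_mono abs_sin_x_le_abs_x) auto
        also have "\<dots> = \<bar>s i + t\<bar> / 2 * x\<^sup>2 * \<bar>s i - t\<bar>"
        proof -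
          have "s i * x + t * x = (s i + t) * x" "t * x - s i * x = - ((s i - t) * x)"
            by (simp_all add: algebra_simps)
          then have "2 * \<bar>(s i * x + t * x) / 2\<bar> * \<bar>(t * x - s i * x) / 2\<bar>
              = \<bar>s i + t\<bar> / 2 * \<bar>x\<bar>\<^sup>2 * \<bar>s i - t\<bar>"
            by (simp only: abs_mult abs_divide abs_minus_cancel power2_eq_square) simp
          then show ?thesis by simp
        qed
        also have "\<dots> \<le> (B + \<bar>t\<bar>) / 2 * x\<^sup>2 * \<bar>s i - t\<bar>"
          using B[of i] by (intro mult_right_mono) auto
        finally have "\<bar>cos (s i * x) - cos (t * x)\<bar> / \<bar>s i - t\<bar> \<le> (B + \<bar>t\<bar>) / 2 * x\<^sup>2"
          using st[of i] by (simp add: field_simps)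
        then have "\<bar>cos (s i * x) - cos (t * x)\<bar> / \<bar>s i - t\<bar> * \<bar>k x\<bar> \<le> (B + \<bar>t\<bar>) / 2 * x\<^sup>2 * \<bar>k x\<bar>"
          by (rule mult_right_mono) simp
        then show "norm (indicator {0<..} x *\<^sub>R ?q i x)
            \<le> indicator {0<..} x *\<^sub>R ((B + \<bar>t\<bar>) / 2 * \<bar>x\<^sup>2 * k x\<bar>)"
          by (simp add: indicator_def abs_mult mult_ac)
      qed
      have "(\<lambda>i. ?q i x) \<longlonglongrightarrow> - sin (t * x) * (x * k x)" for x
      proof -
        have "((\<lambda>s. cos (s * x)) has_real_derivative - sin (t * x) * x) (at t)"
          by (auto intro!: derivative_eq_intros)
        then have "((\<lambda>s. (cos (s * x) - cos (t * x)) / (s - t)) \<longlongrightarrow> - sin (t * x) * x) (at t)"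
          by (simp add: has_field_derivative_iff)
        then have "(\<lambda>i. (cos (s i * x) - cos (t * x)) / (s i - t)) \<longlonglongrightarrow> - sin (t * x) * x"
          using st lim by (auto simp: tendsto_at_iff_sequentially comp_def)
        from tendsto_mult_right[OF this, of "k x"] show ?thesis by (simp add: mult_ac)
      qed
      then show "AE x in lborel. (\<lambda>i. indicator {0<..} x *\<^sub>R ?q i x)
          \<longlonglongrightarrow> indicator {0<..} x *\<^sub>R (- sin (t * x) * (x * k x))"
        by (intro AE_I2 tendsto_scaleR tendsto_const)
    qed
    then show "(\<lambda>i. (?\<psi> (s i) - ?\<psi> t) / (s i - t)) \<longlonglongrightarrow> (LBINT x:{0<..}. - sin (t * x) * (x * k x))"
      by (simp add: quot)
  qed
  then show ?thesis
    by (simp add: has_field_derivative_iff set_lebesgue_integral_def)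
qed

text \<open>Passing from the density \<open>k\<close> to \<open>-(x k)'\<close> amounts to applying \<open>t d/dt\<close> to the transform:
  by parts the new transform is \<open>-t\<close> times the sine transform of \<open>x * k x\<close>, and minus that sine
  transform is the derivative of the old one.\<close>

lemma LBINT_cos_minus_one_Euler:
  fixes k k' \<psi> :: "real \<Rightarrow> real"
  assumes k: "continuous_on {0<..} k" and ki: "set_integrable lborel {0<..} (\<lambda>x. x\<^sup>2 * k x)"
    and \<psi>: "\<And>t. (LBINT x:{0<..}. (cos (t * x) - 1) * k x) = \<psi> t" "(\<psi> has_real_derivative D) (at t)"
    and h: "\<And>x. x > 0 \<Longrightarrow> ((\<lambda>x. x * k x) has_real_derivative - k' x) (at x)"
    and k': "continuous_on {0<..} k'" "set_integrable lborel {0<..} (\<lambda>x. x\<^sup>2 * k' x)"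
    and lims: "((\<lambda>x. x^3 * k x) \<longlongrightarrow> 0) (at_right 0)" "((\<lambda>x. x * k x) \<longlongrightarrow> 0) at_top"
  shows "(LBINT x:{0<..}. (cos (t * x) - 1) * k' x) = t * D"
proof -
  have "(\<psi> has_real_derivative - (LBINT x:{0<..}. sin (t * x) * (x * k x))) (at t)"
    using has_derivative_LBINT_cos_minus_one[OF k ki, of t] by (simp add: \<psi>(1))
  then have D: "D = - (LBINT x:{0<..}. sin (t * x) * (x * k x))"
    using \<psi>(2) DERIV_unique by blast
  show ?thesis
    unfolding D using lims ki
    by (subst LBINT_cos_minus_one_by_parts[OF h k'])
       (auto simp: power2_eq_square power3_eq_cube mult.assoc)
qed

section \<open>The sine transform of the hyperbolic cosecant\<close>

text \<open>Differentiating \<open>rGamma w * rGamma (1 - w) = sin (\<pi> w) / \<pi>\<close> gives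
  \<open>Digamma (1 - z) - Digamma z = \<pi> cot (\<pi> z)\<close>. At \<open>z = 1/2 + i t / \<pi>\<close> the right-hand side is
  \<open>-i \<pi> tanh t\<close>, and the series of the Digamma function on the left has the partial fractions as
  imaginary parts.\<close>

lemma tanh_partial_fractions:
  fixes t :: real
  shows "(\<lambda>n. 2 * (t / (((2 * real n + 1) * pi / 2)\<^sup>2 + t\<^sup>2))) sums tanh t"
proof -
  \<comment> \<open>The real part \<open>1/2\<close> keeps both \<open>z\<close> and \<open>1 - z\<close> away from the poles of the Digamma function.\<close>
  define z :: complex where "z = Complex (1/2) (t / pi)"
  have nonpos: "z \<notin> \<int>\<^sub>\<le>\<^sub>0" "1 - z \<notin> \<int>\<^sub>\<le>\<^sub>0" and nz: "z \<noteq> 0" "1 - z \<noteq> 0"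
    by (auto simp: z_def elim!: nonpos_Ints_cases simp: complex_eq_iff)
  have "((\<lambda>w. rGamma w * rGamma (1 - w)) has_field_derivative
      rGamma z * rGamma (1 - z) * (Digamma (1 - z) - Digamma z)) (at z)"
    using nonpos by (auto intro!: derivative_eq_intros simp: algebra_simps)
  moreover have "((\<lambda>w. rGamma w * rGamma (1 - w)) has_field_derivative cos (of_real pi * z)) (at z)"
    unfolding rGamma_reflection_complex by (auto intro!: derivative_eq_intros)
  ultimately have "rGamma z * rGamma (1 - z) * (Digamma (1 - z) - Digamma z) = cos (of_real pi * z)"
    by (rule DERIV_unique)
  then have reflection: "sin (of_real pi * z) * (Digamma (1 - z) - Digamma z) = of_real pi * cos (of_real pi * z)"
    by (simp add: rGamma_reflection_complex field_simps)
  have piz: "of_real pi * z = of_real (pi / 2) + \<i> * of_real t"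
    by (simp add: z_def complex_eq_iff)
  have sin: "sin (of_real pi * z) = of_real (cosh t)"
    unfolding piz sin_add sin_of_real cos_of_real by (simp add: complex_eq_iff cosh_conv_cos[symmetric] cosh_def Re_exp Im_exp exp_minus field_simps power2_eq_square)
  have cos: "cos (of_real pi * z) = - \<i> * of_real (sinh t)"
    unfolding piz cos_add sin_of_real cos_of_real by (simp add: complex_eq_iff sin_i_times sinh_def Re_exp Im_exp exp_minus field_simps power2_eq_square)
  have "of_real (cosh t) * (Digamma (1 - z) - Digamma z) = - \<i> * of_real pi * of_real (sinh t)"
    using reflection unfolding sin cos by simp
  then have D: "Digamma (1 - z) - Digamma z = - \<i> * of_real pi * of_real (tanh t)"
    by (simp add: tanh_def field_simps)
  have "(\<lambda>n. (inverse (of_nat (Suc n)) - inverse (1 - z + of_nat n)) -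
          (inverse (of_nat (Suc n)) - inverse (z + of_nat n))) sums (Digamma (1 - z) - Digamma z)"
    using sums_diff[OF summable_sums[OF summable_Digamma[OF nz(2)]] summable_sums[OF summable_Digamma[OF nz(1)]]]
    by (simp add: Digamma_def)
  then have "(\<lambda>n. Im (inverse (z + of_nat n) - inverse (1 - z + of_nat n))) sums (- pi * tanh t)"
    by (subst (asm) D) (drule sums_Im, simp)
  then have "(\<lambda>n. (- 1 / pi) * Im (inverse (z + of_nat n) - inverse (1 - z + of_nat n))) sums ((- 1 / pi) * (- pi * tanh t))"
    by (rule sums_mult)
  moreover have "(- 1 / pi) * Im (inverse (z + of_nat n) - inverse (1 - z + of_nat n))
      = 2 * (t / (((2 * real n + 1) * pi / 2)\<^sup>2 + t\<^sup>2))" for n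
  proof -
    have pos: "(1 + real n * 2)\<^sup>2 * pi\<^sup>2 + t\<^sup>2 * 4 > 0"
      by (intro add_pos_nonneg mult_pos_pos) auto
    have "Im (inverse (z + of_nat n)) = - (t / pi) / ((1/2 + real n)\<^sup>2 + (t / pi)\<^sup>2)"
      "Im (inverse (1 - z + of_nat n)) = (t / pi) / ((1/2 + real n)\<^sup>2 + (t / pi)\<^sup>2)"
      by (simp_all add: z_def power2_eq_square)
    moreover have "(t / pi) / ((1/2 + real n)\<^sup>2 + (t / pi)\<^sup>2) = pi * (t / (((2 * real n + 1) * pi / 2)\<^sup>2 + t\<^sup>2))"
    proof -
      have "((2 * real n + 1) * pi / 2)\<^sup>2 + t\<^sup>2 = pi\<^sup>2 * ((1/2 + real n)\<^sup>2 + (t / pi)\<^sup>2)"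
        by (simp add: power2_eq_square field_simps)
      then show ?thesis by (simp add: power2_eq_square)
    qed
    ultimately show ?thesis by simp
  qed
  ultimately show ?thesis by simp
qed

text \<open>The bound on the absolute integral is what makes the termwise integration in \<open>LBINT_sin_csch\<close> legitimate:
  it decays like \<open>1 / a\<^sup>2\<close>, whereas the integral of \<open>exp (- (a * x))\<close> alone is only \<open>1 / a\<close>, which is not
  summable over the exponents of the geometric series.\<close>

lemma LBINT_sin_exp:
  fixes a t :: real
  assumes a: "a > 0"
  shows "set_integrable lborel {0<..} (\<lambda>x. sin (t * x) * exp (- (a * x)))"
    and "(LBINT x:{0<..}. sin (t * x) * exp (- (a * x))) = t / (a\<^sup>2 + t\<^sup>2)"
    and "(LBINT x:{0<..}. \<bar>sin (t * x) * exp (- (a * x))\<bar>) \<le> \<bar>t\<bar> / a\<^sup>2"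
proof -
  have xi: "set_integrable lborel {0<..} (\<lambda>x. x * exp (- (a * x)))"
  proof (rule set_integrable_half_line_limits)
    show "((\<lambda>x. (1 + x\<^sup>2) * (x * exp (- (a * x)))) \<longlongrightarrow> 0) (at_right 0)"
      using a by real_asymp
    show "((\<lambda>x. (1 + x\<^sup>2) * (x * exp (- (a * x)))) \<longlongrightarrow> 0) at_top"
      using a by real_asymp
  qed (intro continuous_intros)
  have xv: "(LBINT x:{0<..}. x * exp (- (a * x))) = 0 - (- 1 / a\<^sup>2)"
  proof (rule LBINT_half_line_FTC[where F = "\<lambda>x. - (x / a + 1 / a\<^sup>2) * exp (- (a * x))"])
    show "((\<lambda>x. - (x / a + 1 / a\<^sup>2) * exp (- (a * x))) has_real_derivative x * exp (- (a * x))) (at x)" for x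
      using a by (auto intro!: derivative_eq_intros simp: field_simps power2_eq_square)
    show "((\<lambda>x. - (x / a + 1 / a\<^sup>2) * exp (- (a * x))) \<longlongrightarrow> - 1 / a\<^sup>2) (at_right 0)"
      using a by (auto intro!: tendsto_eq_intros)
    show "((\<lambda>x. - (x / a + 1 / a\<^sup>2) * exp (- (a * x))) \<longlongrightarrow> 0) at_top"
      using a by real_asymp
  qed (auto intro!: continuous_intros xi)
  show i: "set_integrable lborel {0<..} (\<lambda>x. sin (t * x) * exp (- (a * x)))"
    by (rule set_integrable_sin_times) (auto intro!: continuous_intros xi)
  have pos: "a\<^sup>2 + t\<^sup>2 > 0" using a by (intro add_pos_nonneg) auto
  let ?F = "\<lambda>x. - (exp (- (a * x)) * (a * sin (t * x) + t * cos (t * x)) / (a\<^sup>2 + t\<^sup>2))"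
  have "(LBINT x:{0<..}. sin (t * x) * exp (- (a * x))) = 0 - (- (t / (a\<^sup>2 + t\<^sup>2)))"
  proof (rule LBINT_half_line_FTC[where F = ?F])
    show "(?F has_real_derivative sin (t * x) * exp (- (a * x))) (at x)" for x
    proof -
      have "((\<lambda>x. exp (- (a * x)) * (a * sin (t * x) + t * cos (t * x))) has_real_derivative
          - ((a\<^sup>2 + t\<^sup>2) * (sin (t * x) * exp (- (a * x))))) (at x)"
        by (rule derivative_eq_intros refl | simp add: algebra_simps power2_eq_square)+
      from DERIV_minus[OF DERIV_cdivide[OF this, of "a\<^sup>2 + t\<^sup>2"]] pos a show ?thesis by simp
    qed
    show "(?F \<longlongrightarrow> - (t / (a\<^sup>2 + t\<^sup>2))) (at_right 0)"
      using pos by (auto intro!: tendsto_eq_intros)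
    show "(?F \<longlongrightarrow> 0) at_top"
    proof (rule Lim_null_comparison)
      have "\<bar>a * sin y + t * cos y\<bar> \<le> a + \<bar>t\<bar>" for y
      proof -
        have "\<bar>a * sin y + t * cos y\<bar> \<le> \<bar>a\<bar> * \<bar>sin y\<bar> + \<bar>t\<bar> * \<bar>cos y\<bar>"
          by (metis abs_triangle_ineq abs_mult)
        also have "\<dots> \<le> \<bar>a\<bar> * 1 + \<bar>t\<bar> * 1" by (intro add_mono mult_left_mono) auto
        finally show ?thesis using a by simp
      qed
      then show "\<forall>\<^sub>F x in at_top. norm (?F x) \<le> exp (- (a * x)) * (a + \<bar>t\<bar>) / (a\<^sup>2 + t\<^sup>2)"
        using pos by (intro always_eventually allI) (auto simp: abs_mult intro!: divide_right_mono)
      show "((\<lambda>x. exp (- (a * x)) * (a + \<bar>t\<bar>) / (a\<^sup>2 + t\<^sup>2)) \<longlongrightarrow> 0) at_top"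
        using a by real_asymp
    qed
  qed (auto intro!: continuous_intros i)
  then show "(LBINT x:{0<..}. sin (t * x) * exp (- (a * x))) = t / (a\<^sup>2 + t\<^sup>2)" by simp
  have "(LBINT x:{0<..}. \<bar>sin (t * x) * exp (- (a * x))\<bar>) \<le> (LBINT x:{0<..}. \<bar>t\<bar> * (x * exp (- (a * x))))"
  proof (rule set_integral_mono)
    show "\<bar>sin (t * x) * exp (- (a * x))\<bar> \<le> \<bar>t\<bar> * (x * exp (- (a * x)))" if "x \<in> {0<..}" for x
      using mult_right_mono[OF abs_sin_x_le_abs_x[of "t * x"], of "exp (- (a * x))"] that
      by (simp add: abs_mult mult_ac)
  qed (intro set_integrable_abs i set_integrable_mult_right xi)+
  then show "(LBINT x:{0<..}. \<bar>sin (t * x) * exp (- (a * x))\<bar>) \<le> \<bar>t\<bar> / a\<^sup>2"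
    using xv by (simp add: set_integral_mult_right)
qed

lemma csch_geometric_series:
  assumes "x > 0"
  shows "(\<lambda>n. 2 * exp (- ((2 * real n + 1) * pi / 2 * x))) sums csch (pi * x / 2)"
proof -
  let ?q = "exp (- (pi * x))"
  have q: "norm ?q < 1" using assms by simp
  have "(\<lambda>n. 2 * exp (- (pi * x / 2)) * ?q ^ n) sums (2 * exp (- (pi * x / 2)) * (1 / (1 - ?q)))"
    by (intro sums_mult geometric_sums q)
  moreover have "2 * exp (- (pi * x / 2)) * ?q ^ n = 2 * exp (- ((2 * real n + 1) * pi / 2 * x))" for n
    by (simp add: exp_of_nat_mult[symmetric] mult_exp_exp algebra_simps add_divide_distrib)
  moreover have "2 * exp (- (pi * x / 2)) * (1 / (1 - ?q)) = csch (pi * x / 2)"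
  proof -
    have e: "?q = exp (- (pi * x / 2)) * exp (- (pi * x / 2))" by (simp add: mult_exp_exp)
    have "exp (pi * x / 2) > 1" using assms by simp
    then have "exp (pi * x / 2) * exp (pi * x / 2) > 1"
      by (meson less_trans less_1_mult)
    then show ?thesis unfolding csch_def sinh_def e
      by (simp add: exp_minus field_simps)
  qed
  ultimately show ?thesis by simp
qed

text \<open>Integrating the geometric series of \<open>csch\<close> term by term produces exactly the partial fractions of
  \<open>tanh\<close>.\<close>

theorem LBINT_sin_csch:
  "(LBINT x:{0<..}. sin (t * x) * csch (pi * x / 2)) = tanh t"
proof -
  define a where "a n = (2 * real n + 1) * pi / 2" for n
  define f where "f n x = indicator {0<..} x *\<^sub>R (2 * (sin (t * x) * exp (- (a n * x))))" for n x
  have a: "a n > 0" "a n \<ge> real (Suc n)" for n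
  proof -
    show "a n > 0" unfolding a_def by (simp add: add_nonneg_pos)
    have "(2 * real n + 1) * 1 \<le> (2 * real n + 1) * (pi / 2)"
      using pi_gt3 by (intro mult_left_mono) auto
    have "real (Suc n) \<le> (2 * real n + 1) * 1" by simp
    also have "\<dots> \<le> (2 * real n + 1) * (pi / 2)"
      using pi_gt3 by (intro mult_left_mono) auto
    finally show "a n \<ge> real (Suc n)" by (simp add: a_def)
  qed
  note I = LBINT_sin_exp[OF a(1), of t]
  have fi: "integrable lborel (f n)" for n
    using set_integrable_mult_right[OF I(1), of 2] unfolding f_def set_integrable_def by simp
  have fs: "(\<lambda>n. f n x) sums (indicator {0<..} x *\<^sub>R (sin (t * x) * csch (pi * x / 2)))" for x
  proof (cases "x > 0")
    case True
    from sums_mult[OF csch_geometric_series[OF True], of "sin (t * x)"] True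
    show ?thesis by (simp add: f_def a_def mult_ac)
  qed (simp add: f_def)
  have fn: "summable (\<lambda>n. norm (f n x))" for x
  proof (cases "x > 0")
    case True
    from summable_mult[OF sums_summable[OF csch_geometric_series[OF True]], of "\<bar>sin (t * x)\<bar>"] True
    show ?thesis by (simp add: f_def a_def abs_mult mult_ac)
  qed (simp add: f_def)
  have "summable (\<lambda>n. LINT x|lborel. norm (f n x))"
  proof (rule summable_comparison_test')
    show "summable (\<lambda>n. 2 * \<bar>t\<bar> * inverse (real (Suc n) ^ 2))"
      using inverse_power_summable[of 2, where 'a = real]
      by (intro summable_mult) (simp add: summable_Suc_iff[of "\<lambda>n. inverse (real n ^ 2)"] del: of_nat_Suc)
    show "norm (LINT x|lborel. norm (f n x)) \<le> 2 * \<bar>t\<bar> * inverse (real (Suc n) ^ 2)" for n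
    proof -
      have "norm (f n x) = 2 * (indicator {0<..} x *\<^sub>R \<bar>sin (t * x) * exp (- (a n * x))\<bar>)" for x
        by (simp add: f_def abs_mult)
      then have "(LINT x|lborel. norm (f n x)) = 2 * (LBINT x:{0<..}. \<bar>sin (t * x) * exp (- (a n * x))\<bar>)"
        by (simp only: set_lebesgue_integral_def integral_mult_right_zero)
      also have "\<dots> \<le> 2 * (\<bar>t\<bar> / (a n)\<^sup>2)" using I(3)[of n] by simp
      also have "\<dots> \<le> 2 * (\<bar>t\<bar> / (real (Suc n))\<^sup>2)"
        using a(2)[of n] by (intro mult_left_mono divide_left_mono power_mono mult_pos_pos zero_less_power a) auto
      finally show ?thesis by (simp add: divide_inverse)
    qed
  qed
  then have "(\<lambda>n. integral\<^sup>L lborel (f n)) sums (LINT x|lborel. (\<Sum>n. f n x))"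
    by (intro sums_integral fi AE_I2 fn)
  moreover have "integral\<^sup>L lborel (f n) = 2 * (t / ((a n)\<^sup>2 + t\<^sup>2))" for n
  proof -
    have "integral\<^sup>L lborel (f n) = (LBINT x:{0<..}. 2 * (sin (t * x) * exp (- (a n * x))))"
      unfolding f_def set_lebesgue_integral_def ..
    also have "\<dots> = 2 * (t / ((a n)\<^sup>2 + t\<^sup>2))" by (subst set_integral_mult_right) (simp add: I(2))
    finally show ?thesis .
  qed
  moreover have "(LINT x|lborel. (\<Sum>n. f n x)) = (LBINT x:{0<..}. sin (t * x) * csch (pi * x / 2))"
    using sums_unique[OF fs] by (simp add: set_lebesgue_integral_def)
  ultimately have "(\<lambda>n. 2 * (t / ((a n)\<^sup>2 + t\<^sup>2))) sums (LBINT x:{0<..}. sin (t * x) * csch (pi * x / 2))"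
    by simp
  then show ?thesis using tanh_partial_fractions[of t] sums_unique2 unfolding a_def by blast
qed

section \<open>The three densities and their integrals\<close>

definition density_i :: "real \<Rightarrow> real" where
  "density_i x = (pi / 2) * (cosh (pi * x / 2) / (sinh (pi * x / 2))\<^sup>2)"

definition density_ii :: "real \<Rightarrow> real" where
  "density_ii x = (pi / 4) * csch (pi * x / 2) *
     (pi * x * (coth (pi * x / 2))\<^sup>2 - 2 * coth (pi * x / 2) + pi * x * (csch (pi * x / 2))\<^sup>2)"

definition density_iii :: "real \<Rightarrow> real" where
  "density_iii x = (pi / 8) * csch (pi * x / 2) *
     ((pi * x)\<^sup>2 * coth (pi * x / 2) ^ 3
       + coth (pi * x / 2) * (5 * (pi * x)\<^sup>2 * (csch (pi * x / 2))\<^sup>2 + 4)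
       - 6 * pi * x * (coth (pi * x / 2))\<^sup>2
       - 6 * pi * x * (csch (pi * x / 2))\<^sup>2)"

lemma density_i_csch_coth: "density_i x = (pi / 2) * (csch (pi * x / 2) * coth (pi * x / 2))"
  by (simp add: density_i_def csch_def coth_def power2_eq_square)

lemma has_real_derivative_csch:
  assumes "x > 0"
  shows "((\<lambda>x. csch (pi * x / 2)) has_real_derivative
          - (pi / 2 * (csch (pi * x / 2) * coth (pi * x / 2)))) (at x)"
  using assms unfolding csch_def coth_def
  by (auto intro!: derivative_eq_intros simp: power2_eq_square field_simps)

lemma has_real_derivative_coth:
  assumes "x > 0"
  shows "((\<lambda>x. coth (pi * x / 2)) has_real_derivative - (pi / 2 * (csch (pi * x / 2))\<^sup>2)) (at x)"
proof -
  have "cosh (pi * x / 2) * cosh (pi * x / 2) = 1 + sinh (pi * x / 2) * sinh (pi * x / 2)"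
    using cosh_square_eq[of "pi * x / 2"] by (simp add: power2_eq_square)
  then show ?thesis
    using assms unfolding csch_def coth_def
    by (auto intro!: derivative_eq_intros simp: power2_eq_square divide_simps) (simp add: algebra_simps)
qed

lemma continuous_on_csch: "continuous_on {0<..} (\<lambda>x. csch (pi * x / 2))"
  using has_real_derivative_csch by (intro DERIV_continuous_on) (auto intro: has_field_derivative_at_within)

lemma continuous_on_coth: "continuous_on {0<..} (\<lambda>x. coth (pi * x / 2))"
  using has_real_derivative_coth by (intro DERIV_continuous_on) (auto intro: has_field_derivative_at_within)

lemma continuous_on_density:
  "continuous_on {0<..} density_i" "continuous_on {0<..} density_ii" "continuous_on {0<..} density_iii"
  unfolding density_i_csch_coth[abs_def] density_ii_def[abs_def] density_iii_def[abs_def]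
  by (intro continuous_intros continuous_on_csch continuous_on_coth)+

text \<open>The second and third densities arise from their predecessors by \<open>k \<mapsto> -(x k)'\<close>. This is
  polynomial arithmetic in \<open>csch\<close> and \<open>coth\<close>, because \<open>csch' = - csch * coth\<close> and \<open>coth' = - csch\<^sup>2\<close>.\<close>

lemma has_real_derivative_times_density_i:
  assumes "x > 0" shows "((\<lambda>x. x * density_i x) has_real_derivative - density_ii x) (at x)"
  unfolding density_i_csch_coth density_ii_def
  by (rule derivative_eq_intros has_real_derivative_csch has_real_derivative_coth assms refl)+
     (simp add: field_simps power2_eq_square)

lemma has_real_derivative_times_density_ii:
  assumes "x > 0" shows "((\<lambda>x. x * density_ii x) has_real_derivative - density_iii x) (at x)"
  unfolding density_ii_def density_iii_def
  by (rule derivative_eq_intros has_real_derivative_csch has_real_derivative_coth assms refl)+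
     (simp add: field_simps power2_eq_square power3_eq_cube)

text \<open>All three densities behave like \<open>2 / (\<pi> x\<^sup>2)\<close> at \<open>0\<close> and decay exponentially at infinity.\<close>

lemma set_integrable_square_density:
  "set_integrable lborel {0<..} (\<lambda>x. x\<^sup>2 * density_i x)"
  "set_integrable lborel {0<..} (\<lambda>x. x\<^sup>2 * density_ii x)"
  "set_integrable lborel {0<..} (\<lambda>x. x\<^sup>2 * density_iii x)"
proof -
  show "set_integrable lborel {0<..} (\<lambda>x. x\<^sup>2 * density_i x)"
  proof (rule set_integrable_half_line_limits)
    show "((\<lambda>x. (1 + x\<^sup>2) * (x\<^sup>2 * density_i x)) \<longlongrightarrow> 2 / pi) (at_right 0)"
      unfolding density_i_def by real_asymp (simp add: field_simps power2_eq_square)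
    show "((\<lambda>x. (1 + x\<^sup>2) * (x\<^sup>2 * density_i x)) \<longlongrightarrow> 0) at_top"
      unfolding density_i_def by real_asymp
  qed (intro continuous_intros continuous_on_density)
  show "set_integrable lborel {0<..} (\<lambda>x. x\<^sup>2 * density_ii x)"
  proof (rule set_integrable_half_line_limits)
    show "((\<lambda>x. (1 + x\<^sup>2) * (x\<^sup>2 * density_ii x)) \<longlongrightarrow> 2 / pi) (at_right 0)"
      unfolding density_ii_def csch_def coth_def by real_asymp (simp add: field_simps power2_eq_square)
    show "((\<lambda>x. (1 + x\<^sup>2) * (x\<^sup>2 * density_ii x)) \<longlongrightarrow> 0) at_top"
      unfolding density_ii_def csch_def coth_def by real_asymp
  qed (intro continuous_intros continuous_on_density)
  show "set_integrable lborel {0<..} (\<lambda>x. x\<^sup>2 * density_iii x)"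
  proof (rule set_integrable_half_line_limits)
    show "((\<lambda>x. (1 + x\<^sup>2) * (x\<^sup>2 * density_iii x)) \<longlongrightarrow> 2 / pi) (at_right 0)"
      unfolding density_iii_def csch_def coth_def
      by real_asymp (simp add: field_simps power2_eq_square power3_eq_cube)
    show "((\<lambda>x. (1 + x\<^sup>2) * (x\<^sup>2 * density_iii x)) \<longlongrightarrow> 0) at_top"
      unfolding density_iii_def csch_def coth_def by real_asymp
  qed (intro continuous_intros continuous_on_density)
qed

lemma has_real_derivative_tanh_sech: "(tanh has_real_derivative (sech t)\<^sup>2) (at t)"
proof -
  have "1 - (tanh t)\<^sup>2 = ((cosh t)\<^sup>2 - (sinh t)\<^sup>2) / (cosh t)\<^sup>2"
    by (simp add: tanh_def power_divide diff_divide_distrib)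
  then have "1 - (tanh t)\<^sup>2 = (sech t)\<^sup>2"
    by (simp add: hyperbolic_pythagoras sech_def power_divide)
  then show ?thesis by (auto intro!: derivative_eq_intros)
qed

lemma has_real_derivative_sech: "(sech has_real_derivative - (sech t * tanh t)) (at t)"
  unfolding sech_def[abs_def] tanh_def
  by (auto intro!: derivative_eq_intros simp: power2_eq_square)

lemma LBINT_density_i: "(LBINT x:{0<..}. (cos (t * x) - 1) * density_i x) = - t * tanh t"
proof -
  have "set_integrable lborel {0<..} (\<lambda>x. x * csch (pi * x / 2))"
  proof (rule set_integrable_half_line_limits)
    show "((\<lambda>x. (1 + x\<^sup>2) * (x * csch (pi * x / 2))) \<longlongrightarrow> 2 / pi) (at_right 0)"
      unfolding csch_def by real_asymp
    show "((\<lambda>x. (1 + x\<^sup>2) * (x * csch (pi * x / 2))) \<longlongrightarrow> 0) at_top"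
      unfolding csch_def by real_asymp
  qed (intro continuous_intros continuous_on_csch)
  moreover have "((\<lambda>x. x\<^sup>2 * csch (pi * x / 2)) \<longlongrightarrow> 0) (at_right 0)"
    unfolding csch_def by real_asymp
  moreover have "((\<lambda>x. csch (pi * x / 2)) \<longlongrightarrow> 0) at_top"
    unfolding csch_def by real_asymp
  ultimately show ?thesis
    using LBINT_cos_minus_one_by_parts[OF has_real_derivative_csch[folded density_i_csch_coth]
        continuous_on_density(1) set_integrable_square_density(1), of t]
    by (simp add: LBINT_sin_csch)
qed

lemma LBINT_density_ii: "(LBINT x:{0<..}. (cos (t * x) - 1) * density_ii x) = - t * tanh t - t\<^sup>2 * (sech t)\<^sup>2"
proof -
  have D: "((\<lambda>t. - t * tanh t) has_real_derivative - tanh t - t * (sech t)\<^sup>2) (at t)"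
    by (rule derivative_eq_intros has_real_derivative_tanh_sech refl | simp)+
  have "((\<lambda>x. x ^ 3 * density_i x) \<longlongrightarrow> 0) (at_right 0)" "((\<lambda>x. x * density_i x) \<longlongrightarrow> 0) at_top"
    unfolding density_i_def by real_asymp+
  from LBINT_cos_minus_one_Euler[OF continuous_on_density(1) set_integrable_square_density(1) LBINT_density_i D
      has_real_derivative_times_density_i continuous_on_density(2) set_integrable_square_density(2) this]
  show ?thesis by (simp add: algebra_simps power2_eq_square)
qed

lemma LBINT_density_iii: "(LBINT x:{0<..}. (cos (t * x) - 1) * density_iii x)
    = - t * tanh t - t\<^sup>2 * (3 - 2 * t * tanh t) * (sech t)\<^sup>2"
proof -
  have D: "((\<lambda>t. - t * tanh t - t\<^sup>2 * (sech t)\<^sup>2) has_real_derivative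
      - tanh t - 3 * t * (sech t)\<^sup>2 + 2 * t\<^sup>2 * tanh t * (sech t)\<^sup>2) (at t)"
    by (rule derivative_eq_intros has_real_derivative_tanh_sech has_real_derivative_sech refl)+
       (simp add: algebra_simps power2_eq_square)
  have "((\<lambda>x. x ^ 3 * density_ii x) \<longlongrightarrow> 0) (at_right 0)" "((\<lambda>x. x * density_ii x) \<longlongrightarrow> 0) at_top"
    unfolding density_ii_def csch_def coth_def by real_asymp+
  from LBINT_cos_minus_one_Euler[OF continuous_on_density(2) set_integrable_square_density(2) LBINT_density_ii D
      has_real_derivative_times_density_ii continuous_on_density(3) set_integrable_square_density(3) this]
  show ?thesis by (simp add: algebra_simps power2_eq_square)
qed

section \<open>Nonnegativity of the densities\<close>

lemma density_i_nonneg: "density_i x \<ge> 0" by (simp add: density_i_def)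

lemma sinh_le_times_cosh:
  assumes "u \<ge> (0::real)" shows "sinh u \<le> u * cosh u"
proof -
  have "0 * cosh 0 - sinh 0 \<le> u * cosh u - sinh u"
  proof (rule DERIV_nonneg_imp_nondecreasing[OF assms])
    fix x :: real assume x: "0 \<le> x" "x \<le> u"
    have "((\<lambda>u. u * cosh u - sinh u) has_real_derivative x * sinh x) (at x)"
      by (auto intro!: derivative_eq_intros)
    then show "\<exists>y. ((\<lambda>u. u * cosh u - sinh u) has_real_derivative y) (at x) \<and> 0 \<le> y"
      using x by auto
  qed
  then show ?thesis by simp
qed

lemma density_ii_nonneg:
  assumes "x > 0" shows "density_ii x \<ge> 0"
proof -
  define u where "u = pi * x / 2"
  have u: "u > 0" using assms by (simp add: u_def)
  have s: "csch u > 0" and c: "coth u > 0" using u by (auto simp: csch_def coth_def)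
  have "u * coth u \<ge> 1" using sinh_le_times_cosh[of u] u by (simp add: coth_def field_simps)
  then have "coth u \<le> u * (coth u)\<^sup>2"
    using mult_right_mono[of 1 "u * coth u" "coth u"] c by (simp add: power2_eq_square)
  also have "\<dots> \<le> u * (coth u)\<^sup>2 + u * (csch u)\<^sup>2" using u by simp
  finally have "0 \<le> pi / 4 * csch u * (2 * (u * (coth u)\<^sup>2 + u * (csch u)\<^sup>2 - coth u))"
    using s by (intro mult_nonneg_nonneg) auto
  also have "\<dots> = density_ii x" unfolding density_ii_def u_def by (simp add: algebra_simps)
  finally show ?thesis .
qed

text \<open>A polynomial that, with \<open>v = u\<^sup>2\<close> and multiplied by \<open>v\<close>, lies below the partial sum of order \<open>12\<close>
  in \<open>hyperbolic_inequality\<close>. Up to \<open>v = 3\<close> the constant and linear terms dominate the negative ones. Beyond,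
  after the shift \<open>v = 3 + w\<close>, splitting off a suitable square absorbs the only negative
  coefficient.\<close>

lemma quintic_pos:
  fixes v :: real
  assumes v: "v \<ge> 0"
  shows "4 + 10/3 * v - 77/90 * v\<^sup>2 - 41/420 * v^3 + 1/60 * v^4 + 1/250 * v^5 > 0"
proof (cases "v \<le> 3")
  case True
  have "v * v \<le> 3 * v" using True v by (intro mult_right_mono)
  then have a: "v\<^sup>2 \<le> 3 * v" by (simp add: power2_eq_square)
  have "v * v\<^sup>2 \<le> 3 * (3 * v)" using True v a by (intro mult_mono) auto
  then have "v^3 \<le> 9 * v" by (simp add: power3_eq_cube power2_eq_square)
  moreover have "v^4 \<ge> 0" "v^5 \<ge> 0" using v by auto
  ultimately show ?thesis using True a v by linarith
next
  case False
  define w where "w = v - 3"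
  have w: "w \<ge> 0" "v = 3 + w" using False by (auto simp: w_def)
  have "4 + 10/3 * v - 77/90 * v\<^sup>2 - 41/420 * v^3 + 1/60 * v^4 + 1/250 * v^5
     = 6/25 * (w - 53/25)\<^sup>2
       + (536772/109375 + 33/17500 * w + 37/6300 * w^2 + 971/2100 * w^3 + 23/300 * w^4 + 1/250 * w^5)"
    unfolding w(2) by (simp add: numeral_eq_Suc field_simps)
  moreover have "536772/109375 + 33/17500 * w + 37/6300 * w^2 + 971/2100 * w^3 + 23/300 * w^4 + 1/250 * w^5 > 0"
    using w(1) by (intro add_pos_nonneg) auto
  moreover have "6/25 * (w - 53/25)\<^sup>2 \<ge> 0" by simp
  ultimately show ?thesis by linarith
qed

text \<open>Shifting the index of the hyperbolic series lines all terms of the inequality below up to the same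
  monomials \<open>u ^ n / fact n\<close>.\<close>

lemma sums_square_cosh:
  fixes a u :: real
  shows "(\<lambda>n. if even n then real n * (real n - 1) * a ^ (n - 2) * (u ^ n / fact n) else 0) sums (u\<^sup>2 * cosh (a * u))"
proof -
  let ?g = "\<lambda>n. if even n then real n * (real n - 1) * a ^ (n - 2) * (u ^ n / fact n) else 0"
  have "(\<lambda>n. u\<^sup>2 * (if even n then (a * u) ^ n /\<^sub>R fact n else 0)) sums (u\<^sup>2 * cosh (a * u))"
    by (intro sums_mult cosh_converges)
  moreover have "u\<^sup>2 * (if even n then (a * u) ^ n /\<^sub>R fact n else 0) = ?g (n + 2)" for n
  proof -
    have "real (n + 2) * (real (n + 2) - 1) / fact (n + 2) = 1 / (fact n :: real)"
    proof -
      have "fact (n + 2) = real (n + 2) * (real (n + 2) - 1) * fact n"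
        by (simp add: algebra_simps)
      moreover have "real (n + 2) \<noteq> 0" "real (n + 2) - 1 \<noteq> 0" by auto
      ultimately show ?thesis by (simp del: of_nat_add fact_Suc)
    qed
    moreover have "real (n + 2) * (real (n + 2) - 1) * a ^ n * (u ^ (n + 2) / fact (n + 2))
        = real (n + 2) * (real (n + 2) - 1) / fact (n + 2) * a ^ n * u ^ (n + 2)"
      by simp
    ultimately have "real (n + 2) * (real (n + 2) - 1) * a ^ n * (u ^ (n + 2) / fact (n + 2))
        = 1 / fact n * a ^ n * u ^ (n + 2)"
      by (simp only:)
    then show ?thesis
      by (simp add: power_mult_distrib power_add field_simps power2_eq_square del: of_nat_add fact_Suc)
  qed
  ultimately have "(\<lambda>n. ?g (n + 2)) sums (u\<^sup>2 * cosh (a * u))" by simp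
  then have "?g sums (u\<^sup>2 * cosh (a * u) + (\<Sum>i<2. ?g i))" by (subst (asm) sums_iff_shift)
  then show ?thesis by (simp add: numeral_2_eq_2)
qed

lemma sums_times_sinh:
  fixes a u :: real
  shows "(\<lambda>n. if even n then real n * a ^ (n - 1) * (u ^ n / fact n) else 0) sums (u * sinh (a * u))"
proof -
  let ?g = "\<lambda>n. if even n then real n * a ^ (n - 1) * (u ^ n / fact n) else 0"
  have "(\<lambda>n. u * (if even n then 0 else (a * u) ^ n /\<^sub>R fact n)) sums (u * sinh (a * u))"
    by (intro sums_mult sinh_converges)
  moreover have "u * (if even n then 0 else (a * u) ^ n /\<^sub>R fact n) = ?g (n + 1)" for n
  proof -
    have "real (n + 1) / fact (n + 1) = 1 / (fact n :: real)" by (simp del: of_nat_Suc)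
    moreover have "real (n + 1) * a ^ n * (u ^ (n + 1) / fact (n + 1))
        = real (n + 1) / fact (n + 1) * a ^ n * u ^ (n + 1)"
      by simp
    ultimately have "real (n + 1) * a ^ n * (u ^ (n + 1) / fact (n + 1)) = 1 / fact n * a ^ n * u ^ (n + 1)"
      by (simp only:)
    then show ?thesis
      by (simp add: power_mult_distrib field_simps del: of_nat_Suc)
  qed
  ultimately have "(\<lambda>n. ?g (n + 1)) sums (u * sinh (a * u))" by simp
  then have "?g sums (u * sinh (a * u) + (\<Sum>i<1. ?g i))" by (subst (asm) sums_iff_shift)
  then show ?thesis by simp
qed

text \<open>The coefficients of \<open>u ^ n / fact n\<close> for even \<open>n \<ge> 2\<close> are
  \<open>3 ^ (n - 2) * (n - 1) * (n - 9) + 23 * n\<^sup>2 - 38 * n - 1\<close>. The factor \<open>n - 9\<close> makes those with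
  \<open>n = 6\<close> and \<open>n = 8\<close> negative, while all from \<open>n = 10\<close> onwards are positive. Stopping at order \<open>10\<close> would
  not suffice, as that partial sum becomes negative near \<open>u\<^sup>2 = 5\<close>.\<close>

lemma hyperbolic_inequality:
  fixes u :: real
  shows "0 \<le> u\<^sup>2 * (cosh (3 * u) + 23 * cosh u) - 3 * u * (sinh (3 * u) + 5 * sinh u) + cosh (3 * u) - cosh u"
proof -
  define c :: "nat \<Rightarrow> real" where
    "c n = real n * (real n - 1) * (3 ^ (n - 2) + 23) - 3 * real n * (3 ^ (n - 1) + 5) + 3 ^ n - 1" for n
  define T where "T n = (if even n then c n * (u ^ n / fact n) else 0)" for n
  have T: "T sums (u\<^sup>2 * cosh (3 * u) + 23 * (u\<^sup>2 * cosh (1 * u))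
      - (3 * (u * sinh (3 * u)) + 15 * (u * sinh (1 * u))) + cosh (3 * u) - cosh (1 * u))"
  proof (rule sums_cong[THEN iffD1])
    show "(\<lambda>n. (if even n then real n * (real n - 1) * 3 ^ (n - 2) * (u ^ n / fact n) else 0)
      + 23 * (if even n then real n * (real n - 1) * 1 ^ (n - 2) * (u ^ n / fact n) else 0)
      - (3 * (if even n then real n * 3 ^ (n - 1) * (u ^ n / fact n) else 0)
         + 15 * (if even n then real n * 1 ^ (n - 1) * (u ^ n / fact n) else 0))
      + (if even n then (3 * u) ^ n /\<^sub>R fact n else 0) - (if even n then (1 * u) ^ n /\<^sub>R fact n else 0))
      sums (u\<^sup>2 * cosh (3 * u) + 23 * (u\<^sup>2 * cosh (1 * u))
      - (3 * (u * sinh (3 * u)) + 15 * (u * sinh (1 * u))) + cosh (3 * u) - cosh (1 * u))"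
      by (intro sums_add sums_diff sums_mult sums_square_cosh sums_times_sinh cosh_converges)
    show "(if even n then real n * (real n - 1) * 3 ^ (n - 2) * (u ^ n / fact n) else 0)
      + 23 * (if even n then real n * (real n - 1) * 1 ^ (n - 2) * (u ^ n / fact n) else 0)
      - (3 * (if even n then real n * 3 ^ (n - 1) * (u ^ n / fact n) else 0)
         + 15 * (if even n then real n * 1 ^ (n - 1) * (u ^ n / fact n) else 0))
      + (if even n then (3 * u) ^ n /\<^sub>R fact n else 0) - (if even n then (1 * u) ^ n /\<^sub>R fact n else 0) = T n" for n
      by (simp add: T_def c_def power_mult_distrib algebra_simps divide_inverse)
  qed
  have c_nonneg: "c n \<ge> 0" if n: "n \<ge> 13" for n
  proof -
    obtain m where m: "n = m + 2" using n by (intro that[of "n - 2"]) auto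
    have "c n = 3 ^ (n - 2) * ((real n - 1) * (real n - 9)) + ((real n - 2) * (23 * real n + 8) + 15)"
      unfolding c_def m by (simp add: algebra_simps)
    also have "\<dots> \<ge> 0"
      using n by (intro add_nonneg_nonneg mult_nonneg_nonneg) auto
    finally show ?thesis .
  qed
  have "(\<Sum>n<13. T n) \<le> suminf T"
  proof (rule sum_le_suminf)
    show "T n \<ge> 0" if "n \<in> - {..<13}" for n
      using c_nonneg[of n] that by (auto simp: T_def zero_le_even_power)
  qed (use T in \<open>auto simp: sums_iff\<close>)
  moreover have "(\<Sum>n<13. T n) \<ge> 0"
  proof -
    define v where "v = u\<^sup>2"
    have v: "v \<ge> 0" by (simp add: v_def)
    have "T 1 = 0" "T 3 = 0" "T 5 = 0" "T 7 = 0" "T 9 = 0" "T 11 = 0" by (simp_all add: T_def)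
    then have "(\<Sum>n<13. T n) = T 0 + T 2 + T 4 + T 6 + T 8 + T 10 + T 12"
      by (simp add: eval_nat_numeral)
    also have "\<dots> = 4 * u^2 + 10/3 * u^4 - 77/90 * u^6 - 41/420 * u^8
        + 60968/3628800 * u^10 + 1951472/479001600 * u^12"
      by (simp add: T_def c_def fact_numeral)
    also have "\<dots> = v * (4 + 10/3 * v - 77/90 * v^2 - 41/420 * v^3
        + 60968/3628800 * v^4 + 1951472/479001600 * v^5)"
    proof -
      have powers: "u^2 = v" "u^4 = v^2" "u^6 = v^3" "u^8 = v^4" "u^10 = v^5" "u^12 = v^6"
        by (simp_all add: v_def flip: power_mult)
      show ?thesis unfolding powers by (simp add: numeral_eq_Suc algebra_simps)
    qed
    \<comment> \<open>Rounding the two leading coefficients down is harmless, the margin being large.\<close>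
    also have "\<dots> \<ge> v * (4 + 10/3 * v - 77/90 * v^2 - 41/420 * v^3 + 1/60 * v^4 + 1/250 * v^5)"
      using v by (intro mult_left_mono add_mono mult_right_mono order_refl) auto
    finally show ?thesis using v quintic_pos[OF v] by (meson less_imp_le mult_nonneg_nonneg order_trans)
  qed
  ultimately show ?thesis using T by (simp add: sums_iff algebra_simps)
qed

text \<open>Multiplication by \<open>sinh u ^ 3\<close>, where \<open>u = \<pi> x / 2\<close>, clears the denominators. The triple-angle
  formulas then linearise the products of hyperbolic functions and lead to \<open>hyperbolic_inequality\<close>.\<close>

lemma density_iii_nonneg:
  assumes "x > 0" shows "density_iii x \<ge> 0"
proof -
  define u where "u = pi * x / 2"
  have u: "u > 0" using assms by (simp add: u_def)
  have s: "sinh u > 0" using u by simp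
  have ch2: "cosh u * cosh u = 1 + sinh u * sinh u"
    using cosh_square_eq[of u] by (simp add: power2_eq_square)
  define F where "F = u\<^sup>2 * (cosh u * ((sinh u)\<^sup>2 + 6)) - 3 * u * (sinh u * ((sinh u)\<^sup>2 + 2)) + cosh u * (sinh u)\<^sup>2"
  have c3: "cosh (3 * u) = cosh u + 4 * (cosh u * (sinh u)\<^sup>2)"
  proof -
    have "cosh (3 * u) = cosh (u + (u + u))" by simp
    also have "\<dots> = cosh u * (cosh u * cosh u) + 3 * (cosh u * (sinh u * sinh u))"
      unfolding cosh_add sinh_add by (simp add: algebra_simps)
    finally show ?thesis unfolding ch2 by (simp add: algebra_simps power2_eq_square)
  qed
  have s3: "sinh (3 * u) = 3 * sinh u + 4 * (sinh u * (sinh u)\<^sup>2)"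
  proof -
    have "sinh (3 * u) = sinh (u + (u + u))" by simp
    also have "\<dots> = 3 * (sinh u * (cosh u * cosh u)) + sinh u * (sinh u * sinh u)"
      unfolding cosh_add sinh_add by (simp add: algebra_simps)
    finally show ?thesis unfolding ch2 by (simp add: algebra_simps power2_eq_square)
  qed
  have eq: "4 * F = u\<^sup>2 * (cosh (3 * u) + 23 * cosh u) - 3 * u * (sinh (3 * u) + 5 * sinh u) + cosh (3 * u) - cosh u"
    unfolding F_def c3 s3 by (simp add: algebra_simps)
  have "4 * F \<ge> 0" unfolding eq by (rule hyperbolic_inequality)
  then have F: "F \<ge> 0" by simp
  have px: "pi * x = 2 * u" "6 * pi * x = 6 * (2 * u)" by (simp_all add: u_def)
  have "density_iii x = pi / 2 * csch u * (u\<^sup>2 * (coth u)^3 + 5 * u\<^sup>2 * (coth u * (csch u)\<^sup>2) + coth u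
      - 3 * u * ((coth u)\<^sup>2 + (csch u)\<^sup>2))"
    unfolding density_iii_def px by (simp add: algebra_simps power_mult_distrib)
  also have "u\<^sup>2 * (coth u)^3 + 5 * u\<^sup>2 * (coth u * (csch u)\<^sup>2) + coth u
      - 3 * u * ((coth u)\<^sup>2 + (csch u)\<^sup>2)
    = (u\<^sup>2 * (cosh u * (cosh u * cosh u)) + 5 * u\<^sup>2 * cosh u + cosh u * (sinh u)\<^sup>2
        - 3 * u * (sinh u * (cosh u * cosh u + 1))) / sinh u ^ 3"
  proof -
    \<comment> \<open>Inserting factors \<open>S * i = 1\<close> turns the claim into a polynomial identity.\<close>
    define C S i where "C = cosh u" and "S = sinh u" and "i = 1 / S"
    have Si: "S * i = 1" using s by (simp add: S_def i_def)
    have "u\<^sup>2 * (C * i)^3 + 5 * u\<^sup>2 * ((C * i) * i\<^sup>2) + C * i - 3 * u * ((C * i)\<^sup>2 + i\<^sup>2)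
        = u\<^sup>2 * (C * i)^3 + 5 * u\<^sup>2 * ((C * i) * i\<^sup>2) + C * i * (S * i)\<^sup>2
          - 3 * u * ((C * i)\<^sup>2 + i\<^sup>2) * (S * i)"
      by (simp only: Si power_one mult_1_right)
    also have "\<dots> = (u\<^sup>2 * (C * (C * C)) + 5 * u\<^sup>2 * C + C * S\<^sup>2 - 3 * u * (S * (C * C + 1))) * i ^ 3"
      by (simp add: power2_eq_square power3_eq_cube algebra_simps)
    finally show ?thesis
      unfolding coth_def csch_def C_def[symmetric] S_def[symmetric] by (simp add: i_def power_divide)
  qed
  also have "\<dots> = F / sinh u ^ 3"
    unfolding ch2 F_def by (simp add: algebra_simps power2_eq_square)
  also have "pi / 2 * csch u * (F / sinh u ^ 3) \<ge> 0"
    using F s by (intro mult_nonneg_nonneg divide_nonneg_nonneg) (auto simp: csch_def)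
  finally show ?thesis .
qed

section \<open>The three identities\<close>

theorem lemma2:
  shows
    "((\<forall>t::real.
         set_integrable lborel {0<..} (\<lambda>x::real. (cos (t * x) - 1) *
           (pi / 2) * (cosh (pi * x / 2) / (sinh (pi * x / 2))\<^sup>2)) \<and>
         (LBINT x:{0<..}. (cos (t * x) - 1) *
           (pi / 2) * (cosh (pi * x / 2) / (sinh (pi * x / 2))\<^sup>2))
         = - t * tanh t) \<and>
      levy_exponent (\<lambda>t. complex_of_real (- t * tanh t)))
   \<and> ((\<forall>t::real.
         set_integrable lborel {0<..} (\<lambda>x::real. (cos (t * x) - 1) *
           (pi / 4) * csch (pi * x / 2) *
           (pi * x * (coth (pi * x / 2))\<^sup>2 - 2 * coth (pi * x / 2)
             + pi * x * (csch (pi * x / 2))\<^sup>2)) \<and>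
         (LBINT x:{0<..}. (cos (t * x) - 1) *
           (pi / 4) * csch (pi * x / 2) *
           (pi * x * (coth (pi * x / 2))\<^sup>2 - 2 * coth (pi * x / 2)
             + pi * x * (csch (pi * x / 2))\<^sup>2))
         = - t * tanh t - t\<^sup>2 * (sech t)\<^sup>2) \<and>
      levy_exponent (\<lambda>t. complex_of_real (- t * tanh t - t\<^sup>2 * (sech t)\<^sup>2)))
   \<and> ((\<forall>t::real.
         set_integrable lborel {0<..} (\<lambda>x::real. (cos (t * x) - 1) *
           (pi / 8) * csch (pi * x / 2) *
           ((pi * x)\<^sup>2 * coth (pi * x / 2) ^ 3
             + coth (pi * x / 2) * (5 * (pi * x)\<^sup>2 * (csch (pi * x / 2))\<^sup>2 + 4)
             - 6 * pi * x * (coth (pi * x / 2))\<^sup>2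
             - 6 * pi * x * (csch (pi * x / 2))\<^sup>2)) \<and>
         (LBINT x:{0<..}. (cos (t * x) - 1) *
           (pi / 8) * csch (pi * x / 2) *
           ((pi * x)\<^sup>2 * coth (pi * x / 2) ^ 3
             + coth (pi * x / 2) * (5 * (pi * x)\<^sup>2 * (csch (pi * x / 2))\<^sup>2 + 4)
             - 6 * pi * x * (coth (pi * x / 2))\<^sup>2
             - 6 * pi * x * (csch (pi * x / 2))\<^sup>2))
         = - t * tanh t - t\<^sup>2 * (3 - 2 * t * tanh t) * (sech t)\<^sup>2) \<and>
      levy_exponent (\<lambda>t. complex_of_real
        (- t * tanh t - t\<^sup>2 * (3 - 2 * t * tanh t) * (sech t)\<^sup>2)))"
proof -
  have cont: "continuous_on UNIV (\<lambda>t::real. tanh t)" "continuous_on UNIV sech"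
    using has_real_derivative_tanh_sech has_real_derivative_sech
    by (auto intro!: DERIV_continuous_on)
  have levy1: "levy_exponent (\<lambda>t. complex_of_real (- t * tanh t))"
    by (rule levy_exponent_LBINT[OF continuous_on_density(1) density_i_nonneg set_integrable_square_density(1) LBINT_density_i])
       (intro continuous_intros cont)
  have levy2: "levy_exponent (\<lambda>t. complex_of_real (- t * tanh t - t\<^sup>2 * (sech t)\<^sup>2))"
    by (rule levy_exponent_LBINT[OF continuous_on_density(2) density_ii_nonneg set_integrable_square_density(2) LBINT_density_ii])
       (assumption | intro continuous_intros cont)+
  have levy3: "levy_exponent (\<lambda>t. complex_of_real
        (- t * tanh t - t\<^sup>2 * (3 - 2 * t * tanh t) * (sech t)\<^sup>2))"
    by (rule levy_exponent_LBINT[OF continuous_on_density(3) density_iii_nonneg set_integrable_square_density(3) LBINT_density_iii])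
       (assumption | intro continuous_intros cont)+
  note facts = levy1 levy2 levy3 LBINT_density_i LBINT_density_ii LBINT_density_iii
    set_integrable_cos_minus_one[OF continuous_on_density(1) set_integrable_square_density(1)]
    set_integrable_cos_minus_one[OF continuous_on_density(2) set_integrable_square_density(2)]
    set_integrable_cos_minus_one[OF continuous_on_density(3) set_integrable_square_density(3)]
  show ?thesis
    unfolding mult.assoc
    by (intro conjI allI) (rule facts[unfolded density_i_def density_ii_def density_iii_def mult.assoc])+
qed

end
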